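(* For any set $A\subseteq\omega$, $A\ge_T K$ if and only if there is a function $F\le_T A$ such that for all $n$ and all $x\in\{0,1\}^n$, $F(n)\in\{0,1\}^n$ and $H(x)\le H(F(n))$.
   Context: $K$ denotes the halting problem. $H$ denotes prefix-free Kolmogorov complexity with respect to a fixed universal prefix-free machine on binary strings (the choice of the universal prefix-free machine is arbitrary). *)

theory Defs
  imports "HOL-Library.Nat_Bijection" "HOL-Library.Sublist" "HOL-Library.Extended_Nat"
begin

text \<open>
  Oracle computability on the natural numbers: the least class of unary partial functions that
  contains the constant 0, the successor, the two projections of the pairing function
  \<^const>\<open>prod_encode\<close> and the characteristic function of the oracle, and is closed under pairing,
  composition, primitive recursion and unbounded search. Functions of several arguments are
  represented through \<^const>\<open>prod_encode\<close>.
\<close>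

datatype prog =
    Zero
  | Succ
  | Fst
  | Snd
  | Oracle
  | Pairing prog prog
  | Comp prog prog
  | PrimRec prog prog
  | Mu prog

text \<open>
  The value \<^const>\<open>None\<close> means divergence. With \<open>\<langle>a, k\<rangle>\<close> for the coded pair, \<open>h = PrimRec f g\<close>
  satisfies \<open>h \<langle>a, 0\<rangle> = f a\<close> and \<open>h \<langle>a, k + 1\<rangle> = g \<langle>a, \<langle>k, h \<langle>a, k\<rangle>\<rangle>\<rangle>\<close>, while
  \<open>Mu f\<close> maps \<open>x\<close> to the least \<open>n\<close> with \<open>f \<langle>x, n\<rangle> = 0\<close>, all earlier values being defined and
  nonzero.
\<close>

primrec run :: "nat set \<Rightarrow> prog \<Rightarrow> nat \<Rightarrow> nat option" where
  "run A Zero x = Some 0"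
| "run A Succ x = Some (Suc x)"
| "run A Fst x = Some (fst (prod_decode x))"
| "run A Snd x = Some (snd (prod_decode x))"
| "run A Oracle x = Some (of_bool (x \<in> A))"
| "run A (Pairing f g) x =
     Option.bind (run A f x) (\<lambda>a. Option.bind (run A g x) (\<lambda>b. Some (prod_encode (a, b))))"
| "run A (Comp f g) x = Option.bind (run A g x) (run A f)"
| "run A (PrimRec f g) x =
     (let (a, k) = prod_decode x in
      rec_nat (run A f a)
        (\<lambda>i r. Option.bind r (\<lambda>v. run A g (prod_encode (a, prod_encode (i, v))))) k)"
| "run A (Mu f) x =
     (let P = (\<lambda>n. run A f (prod_encode (x, n)) = Some 0 \<and>
                   (\<forall>m<n. \<exists>v>0. run A f (prod_encode (x, m)) = Some v))
      in if \<exists>n. P n then Some (LEAST n. P n) else None)"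

definition computable_in :: "nat set \<Rightarrow> (nat \<Rightarrow> nat) \<Rightarrow> bool" where
  "computable_in A f \<longleftrightarrow> (\<exists>p. \<forall>x. run A p x = Some (f x))"

definition turing_reducible :: "nat set \<Rightarrow> nat set \<Rightarrow> bool" (infix "\<le>\<^sub>T" 50) where
  "B \<le>\<^sub>T A \<longleftrightarrow> computable_in A (\<lambda>x. of_bool (x \<in> B))"

primrec index :: "prog \<Rightarrow> nat" where
  "index Zero = 0"
| "index Succ = 1"
| "index Fst = 2"
| "index Snd = 3"
| "index Oracle = 4"
| "index (Pairing f g) = 5 + 4 * prod_encode (index f, index g)"
| "index (Comp f g) = 6 + 4 * prod_encode (index f, index g)"
| "index (PrimRec f g) = 7 + 4 * prod_encode (index f, index g)"
| "index (Mu f) = 8 + 4 * index f"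

text \<open>Computability without an oracle is computability with the empty oracle.\<close>

definition halting_problem :: "nat set" where
  "halting_problem = {index p | p. run {} p (index p) \<noteq> None}"

text \<open>Bijective base-2 numeration identifies binary strings with natural numbers.\<close>

primrec string_code :: "bool list \<Rightarrow> nat" where
  "string_code [] = 0"
| "string_code (b # bs) = 2 * string_code bs + (if b then 2 else 1)"

definition string_fun_computable_in :: "nat set \<Rightarrow> (nat \<Rightarrow> bool list) \<Rightarrow> bool" where
  "string_fun_computable_in A F \<longleftrightarrow> computable_in A (\<lambda>n. string_code (F n))"

definition prefix_free_machine :: "(bool list \<Rightarrow> bool list option) \<Rightarrow> bool" where
  "prefix_free_machine M \<longleftrightarrow>
     (\<exists>p. \<forall>\<sigma>. run {} p (string_code \<sigma>) = map_option string_code (M \<sigma>)) \<and>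
     (\<forall>\<sigma>\<in>dom M. \<forall>\<tau>\<in>dom M. prefix \<sigma> \<tau> \<longrightarrow> \<sigma> = \<tau>)"

text \<open>
  Universality asks for simulation of every prefix-free machine with constant overhead in program
  length. Machines \<open>U\<close> with \<open>U (\<rho> @ \<sigma>) = M \<sigma>\<close> for a fixed string \<open>\<rho>\<close> depending on \<open>M\<close>
  are a special case.
\<close>

definition universal_prefix_free_machine :: "(bool list \<Rightarrow> bool list option) \<Rightarrow> bool" where
  "universal_prefix_free_machine U \<longleftrightarrow>
     prefix_free_machine U \<and>
     (\<forall>M. prefix_free_machine M \<longrightarrow>
        (\<exists>c. \<forall>\<sigma>\<in>dom M. \<exists>\<tau>. U \<tau> = M \<sigma> \<and> length \<tau> \<le> length \<sigma> + c))"

definition prefix_complexity :: "(bool list \<Rightarrow> bool list option) \<Rightarrow> bool list \<Rightarrow> enat" where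
  "prefix_complexity U x = Inf {enat (length \<sigma>) | \<sigma>. U \<sigma> = Some x}"

end

theory Submission
  imports Defs Complex_Main
begin

text \<open>
  Given the halting problem, the complexities of all strings of length \<open>n\<close> can be compared, so a string of
  maximal complexity can be found.

  Conversely, let \<open>F\<close> pick strings of maximal complexity and let \<open>n + \<mu>(n)\<close> be the largest complexity
  at length \<open>n\<close>. By a Kraft-Chaitin construction a suitable \<open>2\<^sup>-\<^sup>d\<close> fraction of the strings of length \<open>n\<close>,
  depending on the current approximation of \<open>\<mu>(n)\<close>, can be given programs shorter than \<open>n + \<mu>(n)\<close>; hence the
  residue of \<open>F n\<close> modulo \<open>2\<^sup>d\<close> differs from any prescribed computable function of \<open>n\<close> and \<open>\<mu>(n)\<close>
  with values below \<open>2\<^sup>d\<close>. Prescribe a height that decreases as \<open>\<mu>(n)\<close> drops. On a large block of lengths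
  the height is lowered one by one, each time on a smaller block on which it has not dropped by itself, when
  the next entry of a finite sequence \<open>x\<close> enters the halting problem. If the halting problem were not
  reducible to \<open>A\<close>, the entries could be chosen such that each of them enters only after \<open>A\<close> has seen that
  \<open>F\<close> avoids the current height, and all heights would be exhausted.
\<close>

section \<open>Oracle computability\<close>

text \<open>The excess \<mu>(n) is unbounded in \<open>n\<close> and only approximable from above,
  so no fixed residue can be prohibited for good: the prohibited one has to follow the
  approximation, whose last value is never known to be the last. Two costs fix the shape of the
  blocks. Forcing the excess down to \<open>m\<close> on \<open>2^B\<close> lengths takes weight
  about \<open>2^(B - m)\<close>, so a block must be small compared with its threshold. The
  universal machine may lower excesses too, but by Kraft's inequality on at most \<open>2^m\<close>
  lengths down to \<open>m\<close>; a block with more than that many disjoint sub-blocks has one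
  that is left alone. Meeting both demands doubles the threshold from each height to the next.
  Simulation constants are known only after a machine is fixed. Hence each machine serves all
  \<open>k\<close> and all games at once, with a share \<open>2^-(k+1)\<close> of its weight for
  \<open>k\<close>, and \<open>k\<close> is chosen last, above the constants. Prohibiting a
  \<open>4^-k\<close> fraction saves \<open>2 k\<close> bits and the share costs
  \<open>k + 1\<close>, which is why the modulus is \<open>4^k\<close> and not
  \<open>2^k\<close>.\<close>

definition decidable_in :: "nat set \<Rightarrow> (nat \<Rightarrow> bool) \<Rightarrow> bool" where
  "decidable_in A P \<longleftrightarrow> computable_in A (\<lambda>x. of_bool (P x))"

abbreviation pfst :: "nat \<Rightarrow> nat" where "pfst z \<equiv> fst (prod_decode z)"
abbreviation psnd :: "nat \<Rightarrow> nat" where "psnd z \<equiv> snd (prod_decode z)"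
abbreviation pair :: "nat \<Rightarrow> nat \<Rightarrow> nat" where "pair a b \<equiv> prod_encode (a, b)"

text \<open>Syntax-directed closure rules: computability and decidability goals are solved by
  following the shape of the term.\<close>

named_theorems comp_intros

lemma computable_zero: "computable_in A (\<lambda>x. 0)"
  unfolding computable_in_def by (intro exI[of _ Zero]) simp

lemma computable_id [comp_intros]: "computable_in A (\<lambda>x. x)"
  unfolding computable_in_def by (intro exI[of _ "Pairing Fst Snd"]) simp

lemma computable_comp:
  assumes "computable_in A f" "computable_in A g"
  shows "computable_in A (\<lambda>x. f (g x))"
proof -
  obtain p q where "\<forall>x. run A p x = Some (f x)" "\<forall>x. run A q x = Some (g x)"
    using assms unfolding computable_in_def by blast
  then have "\<forall>x. run A (Comp p q) x = Some (f (g x))" by simp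
  then show ?thesis unfolding computable_in_def by blast
qed

lemma decidable_comp: "decidable_in A P \<Longrightarrow> computable_in A g \<Longrightarrow> decidable_in A (\<lambda>x. P (g x))"
  unfolding decidable_in_def by (rule computable_comp)

lemma computable_Suc [comp_intros]: "computable_in A f \<Longrightarrow> computable_in A (\<lambda>x. Suc (f x))"
  by (rule computable_comp[of A Suc]) (auto simp: computable_in_def intro: exI[of _ Succ])

lemma computable_const [comp_intros]: "computable_in A (\<lambda>x. c)"
  by (induction c) (auto intro: computable_zero computable_Suc)

lemma computable_pfst [comp_intros]: "computable_in A f \<Longrightarrow> computable_in A (\<lambda>x. pfst (f x))"
  by (rule computable_comp[of A pfst]) (auto simp: computable_in_def intro: exI[of _ Fst])

lemma computable_psnd [comp_intros]: "computable_in A f \<Longrightarrow> computable_in A (\<lambda>x. psnd (f x))"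
  by (rule computable_comp[of A psnd]) (auto simp: computable_in_def intro: exI[of _ Snd])

lemma computable_pair [comp_intros]:
  assumes "computable_in A f" "computable_in A g"
  shows "computable_in A (\<lambda>x. pair (f x) (g x))"
proof -
  obtain p q where "\<forall>x. run A p x = Some (f x)" "\<forall>x. run A q x = Some (g x)"
    using assms unfolding computable_in_def by blast
  then have "\<forall>x. run A (Pairing p q) x = Some (pair (f x) (g x))" by simp
  then show ?thesis unfolding computable_in_def by blast
qed

lemma computable_rec [comp_intros]:
  assumes f: "computable_in A f"
    and g: "computable_in A (\<lambda>z. g (pfst z) (pfst (psnd z)) (psnd (psnd z)))"
    and b: "computable_in A b"
  shows "computable_in A (\<lambda>x. rec_nat (f x) (g x) (b x))"
proof -
  obtain p q where p: "\<forall>x. run A p x = Some (f x)"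
    and q: "\<forall>z. run A q z = Some (g (pfst z) (pfst (psnd z)) (psnd (psnd z)))"
    using f g unfolding computable_in_def by blast
  have *: "rec_nat (run A p a)
      (\<lambda>i r. Option.bind r (\<lambda>v. run A q (prod_encode (a, prod_encode (i, v))))) k
      = Some (rec_nat (f a) (g a) k)" for a k
    by (induction k) (simp_all add: p q)
  have "computable_in A (\<lambda>z. rec_nat (f (pfst z)) (g (pfst z)) (psnd z))"
    unfolding computable_in_def
    by (intro exI[of _ "PrimRec p q"]) (simp add: * split: prod.split)
  from computable_comp[OF this computable_pair[OF computable_id b]] show ?thesis by simp
qed

lemma computable_add [comp_intros]:
  assumes "computable_in A f" "computable_in A g"
  shows "computable_in A (\<lambda>x. f x + g x)"
proof -
  have "rec_nat a (\<lambda>i v. Suc v) b = a + b" for a b :: nat by (induction b) auto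
  then show ?thesis
    using computable_rec[OF assms(1) _ assms(2), of "\<lambda>x i v. Suc v"] by (simp add: comp_intros)
qed

lemma computable_mult [comp_intros]:
  assumes "computable_in A f" "computable_in A g"
  shows "computable_in A (\<lambda>x. f x * g x)"
proof -
  have "rec_nat 0 (\<lambda>i v. v + a) b = a * b" for a b :: nat by (induction b) auto
  then show ?thesis
    using computable_rec[OF computable_zero _ assms(2), of "\<lambda>x i v. v + f x"]
      computable_comp[OF assms(1)]
    by (simp add: comp_intros)
qed

lemma computable_pow [comp_intros]:
  assumes "computable_in A f" "computable_in A g"
  shows "computable_in A (\<lambda>x. f x ^ g x)"
proof -
  have "rec_nat 1 (\<lambda>i v. v * a) b = a ^ b" for a b :: nat by (induction b) auto
  then show ?thesis
    using computable_rec[OF computable_const[of _ 1] _ assms(2), of "\<lambda>x i v. v * f x"]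
      computable_comp[OF assms(1)]
    by (simp add: comp_intros)
qed

lemma computable_diff [comp_intros]:
  assumes "computable_in A f" "computable_in A g"
  shows "computable_in A (\<lambda>x. f x - g x)"
proof -
  have *: "rec_nat 0 (\<lambda>i v. i) b = b - 1" for b :: nat by (induction b) auto
  have pred: "computable_in A h \<Longrightarrow> computable_in A (\<lambda>x. h x - 1)" for h
    using computable_rec[OF computable_zero, of A "\<lambda>x i v. i" h]
    unfolding * by (simp add: comp_intros)
  have "rec_nat a (\<lambda>i v. v - 1) b = a - b" for a b :: nat by (induction b) auto
  then show ?thesis
    using computable_rec[OF assms(1) _ assms(2), of "\<lambda>x i v. v - 1"] pred by (simp add: comp_intros)
qed

lemma computable_of_bool [comp_intros]:
  "decidable_in A P \<Longrightarrow> computable_in A (\<lambda>x. of_bool (P x))"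
  by (simp add: decidable_in_def)

lemma decidable_const [comp_intros]: "decidable_in A (\<lambda>x. c)"
  unfolding decidable_in_def by (rule comp_intros)

lemma decidable_less [comp_intros]:
  assumes "computable_in A f" "computable_in A g"
  shows "decidable_in A (\<lambda>x. f x < g x)"
proof -
  have *: "of_bool (a < b) = 1 - (1 - (b - a))" for a b :: nat by auto
  show ?thesis unfolding decidable_in_def * by (intro comp_intros assms)
qed

lemma decidable_not [comp_intros]: "decidable_in A P \<Longrightarrow> decidable_in A (\<lambda>x. \<not> P x)"
proof -
  have *: "of_bool (\<not> b) = (1 - of_bool b :: nat)" for b by auto
  show "decidable_in A P \<Longrightarrow> ?thesis"
    unfolding decidable_in_def[of _ "\<lambda>x. \<not> P x"] * by (intro comp_intros)
qed

lemma decidable_le [comp_intros]: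
  "computable_in A f \<Longrightarrow> computable_in A g \<Longrightarrow> decidable_in A (\<lambda>x. f x \<le> g x)"
  unfolding not_less[symmetric] by (intro comp_intros)

lemma decidable_conj [comp_intros]:
  "decidable_in A P \<Longrightarrow> decidable_in A Q \<Longrightarrow> decidable_in A (\<lambda>x. P x \<and> Q x)"
  unfolding decidable_in_def[of _ "\<lambda>x. P x \<and> Q x"] of_bool_conj by (intro comp_intros)

lemma decidable_disj [comp_intros]:
  "decidable_in A P \<Longrightarrow> decidable_in A Q \<Longrightarrow> decidable_in A (\<lambda>x. P x \<or> Q x)"
proof -
  have *: "(a \<or> b) = (\<not> (\<not> a \<and> \<not> b))" for a b by auto
  show "decidable_in A P \<Longrightarrow> decidable_in A Q \<Longrightarrow> ?thesis"
    unfolding * by (intro comp_intros)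
qed

lemma decidable_imp [comp_intros]:
  "decidable_in A P \<Longrightarrow> decidable_in A Q \<Longrightarrow> decidable_in A (\<lambda>x. P x \<longrightarrow> Q x)"
  unfolding imp_conv_disj by (intro comp_intros)

lemma decidable_eq [comp_intros]:
  "computable_in A f \<Longrightarrow> computable_in A g \<Longrightarrow> decidable_in A (\<lambda>x. f x = g x)"
  unfolding eq_iff by (intro comp_intros)

lemma computable_if [comp_intros]:
  assumes "decidable_in A P" "computable_in A f" "computable_in A g"
  shows "computable_in A (\<lambda>x. if P x then f x else g x)"
proof -
  have *: "(if b then u else v) = of_bool b * u + of_bool (\<not> b) * v" for b and u v :: nat by auto
  show ?thesis unfolding * by (intro comp_intros assms)
qed

lemma decidable_all_less [comp_intros]:
  assumes "decidable_in A (\<lambda>z. P (pfst z) (psnd z))" "computable_in A b"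
  shows "decidable_in A (\<lambda>x. \<forall>m<b x. P x m)"
proof -
  have *: "of_bool (\<forall>m<k. P x m) = rec_nat (1 :: nat) (\<lambda>i v. v * of_bool (P x i)) k" for k x
    by (induction k) (simp_all add: All_less_Suc of_bool_conj mult.commute conj_commute del: of_bool_eq_1_iff)
  have "computable_in A (\<lambda>z. pair (pfst z) (pfst (psnd z)))" by (intro comp_intros)
  from decidable_comp[OF assms(1) this]
  have "decidable_in A (\<lambda>z. P (pfst z) (pfst (psnd z)))" by simp
  then show ?thesis
    unfolding decidable_in_def[of A "\<lambda>x. \<forall>m<b x. P x m"] * by (intro comp_intros assms)
qed

lemma decidable_ex_less [comp_intros]:
  assumes "decidable_in A (\<lambda>z. P (pfst z) (psnd z))" "computable_in A b"
  shows "decidable_in A (\<lambda>x. \<exists>m<b x. P x m)"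
proof -
  have *: "(\<exists>m<k. P x m) = (\<not> (\<forall>m<k. \<not> P x m))" for k x by auto
  show ?thesis unfolding * by (intro comp_intros assms)
qed

text \<open>For a total test with values 0 and 1, the demand of \<open>Mu\<close> on earlier values
  is automatic at the first hit.\<close>

lemma run_Mu:
  assumes "\<And>z. run A q z = Some (of_bool (\<not> P (pfst z) (psnd z)))"
  shows "run A (Mu q) x = (if \<exists>n. P x n then Some (LEAST n. P x n) else None)"
proof -
  define Q where "Q = (\<lambda>n. run A q (pair x n) = Some 0 \<and> (\<forall>m<n. \<exists>v>0. run A q (pair x m) = Some v))"
  have Q: "Q n \<longleftrightarrow> P x n \<and> (\<forall>m<n. \<not> P x m)" for n
    by (auto simp: Q_def assms)
  have ex: "(\<exists>n. Q n) \<longleftrightarrow> (\<exists>n. P x n)"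
    unfolding Q by (meson not_less_Least LeastI_ex)
  have "(LEAST n. Q n) = (LEAST n. P x n)" if "P x m" for m
  proof (rule Least_equality)
    show "Q (LEAST n. P x n)" unfolding Q using that by (metis LeastI not_less_Least)
    show "(LEAST n. P x n) \<le> n" if "Q n" for n using that unfolding Q by (auto intro: Least_le)
  qed
  then show ?thesis using ex by (auto simp: Q_def[symmetric])
qed

lemma computable_Least [comp_intros]:
  assumes "decidable_in A (\<lambda>z. P (pfst z) (psnd z))" "\<And>x. \<exists>n. P x n"
  shows "computable_in A (\<lambda>x. LEAST n. P x n)"
proof -
  have "computable_in A (\<lambda>z. of_bool (\<not> P (pfst z) (psnd z)))"
    by (intro comp_intros assms)
  then obtain q where q: "\<And>z. run A q z = Some (of_bool (\<not> P (pfst z) (psnd z)))"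
    unfolding computable_in_def by blast
  show ?thesis unfolding computable_in_def
    by (intro exI[of _ "Mu q"]) (use assms(2) in \<open>simp del: run.simps(9) add: run_Mu[of A q, OF q]\<close>)
qed

lemma partial_search_prog:
  assumes "decidable_in A (\<lambda>z. P (pfst z) (psnd z))" "computable_in A (\<lambda>z. g (pfst z) (psnd z))"
  shows "\<exists>p. \<forall>x. run A p x = (if \<exists>n. P x n then Some (g x (LEAST n. P x n)) else None)"
proof -
  have "computable_in A (\<lambda>z. of_bool (\<not> P (pfst z) (psnd z)))"
    by (intro comp_intros assms)
  then obtain q where q: "\<And>z. run A q z = Some (of_bool (\<not> P (pfst z) (psnd z)))"
    unfolding computable_in_def by blast
  obtain r where r: "\<And>z. run A r z = Some (g (pfst z) (psnd z))"
    using assms(2) unfolding computable_in_def by blast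
  obtain i where i: "\<And>x. run A i x = Some x"
    using computable_id unfolding computable_in_def by blast
  show ?thesis
    by (intro exI[of _ "Comp r (Pairing i (Mu q))"])
      (simp del: run.simps(9) add: r i run_Mu[of A q, OF q])
qed

lemma computable_div [comp_intros]:
  assumes "computable_in A f" "computable_in A g"
  shows "computable_in A (\<lambda>x. f x div g x)"
proof -
  have ex: "b = 0 \<or> a < Suc (a div b) * b" for a b :: nat
    using dividend_less_div_times[of b a] by auto
  have *: "a div b = (LEAST q. b = 0 \<or> a < Suc q * b)" for a b :: nat
  proof (rule Least_equality[symmetric])
    show "b = 0 \<or> a < Suc (a div b) * b" by (rule ex)
    show "a div b \<le> q" if "b = 0 \<or> a < Suc q * b" for q
      using that by (metis div_by_0 le0 less_Suc_eq_le less_mult_imp_div_less)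
  qed
  show ?thesis unfolding *
    by (intro comp_intros assms computable_comp[OF assms(1)] computable_comp[OF assms(2)])
      (use ex in blast)
qed

lemma computable_mod [comp_intros]:
  "computable_in A f \<Longrightarrow> computable_in A g \<Longrightarrow> computable_in A (\<lambda>x. f x mod g x)"
  unfolding modulo_nat_def by (intro comp_intros)

lemma decidable_set_decode [comp_intros]:
  "computable_in A f \<Longrightarrow> computable_in A g \<Longrightarrow> decidable_in A (\<lambda>x. f x \<in> set_decode (g x))"
  unfolding set_decode_def mem_Collect_eq odd_iff_mod_2_eq_one by (intro comp_intros)

lemma computable_funpow:
  assumes "computable_in A g" "computable_in A b" "computable_in A f"
  shows "computable_in A (\<lambda>x. (g ^^ b x) (f x))"
proof -
  have *: "(g ^^ n) a = rec_nat a (\<lambda>i v. g v) n" for n a by (induction n) auto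
  show ?thesis unfolding * by (intro comp_intros assms computable_comp[OF assms(1)])
qed

section \<open>Halting computations\<close>

text \<open>One-step check of the claim that \<open>e\<close> maps \<open>x\<close> to
  \<open>y\<close>, coded as \<open>pair e (pair x y)\<close>, against the claims in
  \<open>S\<close>. The cases undo the arithmetic of \<open>index\<close>; \<open>e = 4\<close> is
  the empty oracle. A finite set passing its own check certifies its computations, which replaces an
  interpreter.\<close>

definition justified :: "nat set \<Rightarrow> nat \<Rightarrow> nat \<Rightarrow> nat \<Rightarrow> bool" where
  "justified S e x y \<longleftrightarrow>
     (e = 0 \<and> y = 0) \<or> (e = 1 \<and> y = Suc x) \<or> (e = 2 \<and> y = pfst x) \<or> (e = 3 \<and> y = psnd x) \<or>
     (e = 4 \<and> y = 0) \<or>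
     (5 \<le> e \<and> (e - 5) mod 4 = 0 \<and>
        pair (pfst ((e - 5) div 4)) (pair x (pfst y)) \<in> S \<and>
        pair (psnd ((e - 5) div 4)) (pair x (psnd y)) \<in> S) \<or>
     (5 \<le> e \<and> (e - 5) mod 4 = 1 \<and>
        (\<exists>v. pair (psnd ((e - 5) div 4)) (pair x v) \<in> S \<and>
             pair (pfst ((e - 5) div 4)) (pair v y) \<in> S)) \<or>
     (5 \<le> e \<and> (e - 5) mod 4 = 2 \<and> psnd x = 0 \<and>
        pair (pfst ((e - 5) div 4)) (pair (pfst x) y) \<in> S) \<or>
     (5 \<le> e \<and> (e - 5) mod 4 = 2 \<and> 0 < psnd x \<and>
        (\<exists>v. pair e (pair (pair (pfst x) (psnd x - 1)) v) \<in> S \<and>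
             pair (psnd ((e - 5) div 4)) (pair (pair (pfst x) (pair (psnd x - 1) v)) y) \<in> S)) \<or>
     (5 \<le> e \<and> (e - 5) mod 4 = 3 \<and>
        pair ((e - 5) div 4) (pair (pair x y) 0) \<in> S \<and>
        (\<forall>m<y. \<exists>v. 0 < v \<and> pair ((e - 5) div 4) (pair (pair x m) v) \<in> S))"

definition derivation :: "nat set \<Rightarrow> bool" where
  "derivation S \<longleftrightarrow> (\<forall>c\<in>S. justified S (pfst c) (pfst (psnd c)) (psnd (psnd c)))"

lemma justified_mono: "justified S e x y \<Longrightarrow> S \<subseteq> S' \<Longrightarrow> justified S' e x y"
  unfolding justified_def
  by (elim disj_forward conj_forward ex_forward all_forward imp_forward) auto

lemma index_arith [simp]:
  "(5 + 4 * m - 5) mod 4 = (0::nat)" "(5 + 4 * m - 5) div 4 = (m::nat)"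
  "(6 + 4 * m - 5) mod 4 = (1::nat)" "(6 + 4 * m - 5) div 4 = (m::nat)"
  "(7 + 4 * m - 5) mod 4 = (2::nat)" "(7 + 4 * m - 5) div 4 = (m::nat)"
  "(8 + 4 * m - 5) mod 4 = (3::nat)" "(8 + 4 * m - 5) div 4 = (m::nat)"
proof -
  have "6 + 4 * m - 5 = 1 + 4 * m" "7 + 4 * m - 5 = 2 + 4 * m" "8 + 4 * m - 5 = 3 + 4 * m" by simp_all
  then show "(5 + 4 * m - 5) mod 4 = 0" "(5 + 4 * m - 5) div 4 = m"
    "(6 + 4 * m - 5) mod 4 = 1" "(6 + 4 * m - 5) div 4 = m"
    "(7 + 4 * m - 5) mod 4 = 2" "(7 + 4 * m - 5) div 4 = m"
    "(8 + 4 * m - 5) mod 4 = 3" "(8 + 4 * m - 5) div 4 = m"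
    by (simp_all only: add_diff_cancel_left' mod_mult_self2 div_mult_self2 mod_mult_self1_is_0
        nonzero_mult_div_cancel_left) simp_all
qed

lemma justified_simps:
  "justified S 0 x y \<longleftrightarrow> y = 0"
  "justified S (Suc 0) x y \<longleftrightarrow> y = Suc x"
  "justified S 2 x y \<longleftrightarrow> y = pfst x"
  "justified S 3 x y \<longleftrightarrow> y = psnd x"
  "justified S 4 x y \<longleftrightarrow> y = 0"
  "justified S (5 + 4 * pair f g) x y \<longleftrightarrow>
     pair f (pair x (pfst y)) \<in> S \<and> pair g (pair x (psnd y)) \<in> S"
  "justified S (6 + 4 * pair f g) x y \<longleftrightarrow>
     (\<exists>v. pair g (pair x v) \<in> S \<and> pair f (pair v y) \<in> S)"
  "justified S (7 + 4 * pair f g) (pair a 0) y \<longleftrightarrow> pair f (pair a y) \<in> S"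
  "justified S (7 + 4 * pair f g) (pair a (Suc k)) y \<longleftrightarrow>
     (\<exists>v. pair (7 + 4 * pair f g) (pair (pair a k) v) \<in> S \<and> pair g (pair (pair a (pair k v)) y) \<in> S)"
  "justified S (8 + 4 * f) x y \<longleftrightarrow>
     pair f (pair (pair x y) 0) \<in> S \<and> (\<forall>m<y. \<exists>v. 0 < v \<and> pair f (pair (pair x m) v) \<in> S)"
  unfolding justified_def index_arith by simp_all

text \<open>
  No ordering of the entries of a derivation is needed: a justification refers to smaller programs,
  or to the same primitive recursion with a smaller counter.
\<close>

lemma derivation_sound:
  assumes S: "derivation S"
  shows "pair (index p) (pair x y) \<in> S \<Longrightarrow> run {} p x = Some y"
proof (induction p arbitrary: x y)
  have J: "justified S e x y" if "pair e (pair x y) \<in> S" for e x y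
    using S that unfolding derivation_def by fastforce
  {
    case Zero
    from J[OF this] show ?case by (simp add: justified_simps)
  next
    case Succ
    from J[OF this] show ?case by (simp add: justified_simps)
  next
    case Fst
    from J[OF this] show ?case by (simp add: justified_simps)
  next
    case Snd
    from J[OF this] show ?case by (simp add: justified_simps)
  next
    case Oracle
    from J[OF this] show ?case by (simp add: justified_simps)
  next
    case (Pairing f g)
    from J[OF Pairing.prems] show ?case
      using Pairing.IH by (auto simp: justified_simps)
  next
    case (Comp f g)
    from J[OF Comp.prems] show ?case
      using Comp.IH by (fastforce simp: justified_simps)
  next
    case (PrimRec f g)
    obtain a k where x: "x = pair a k" by (metis prod_decode_inverse surj_pair)
    have "pair (index (PrimRec f g)) (pair (pair a k) y) \<in> S
        \<Longrightarrow> run {} (PrimRec f g) (pair a k) = Some y" for k y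
    proof (induction k arbitrary: y)
      case 0
      from J[OF this] show ?case using PrimRec.IH(1) by (simp add: justified_simps)
    next
      case (Suc k)
      from J[OF Suc.prems] obtain v where
        v: "pair (index (PrimRec f g)) (pair (pair a k) v) \<in> S"
        "pair (index g) (pair (pair a (pair k v)) y) \<in> S"
        by (auto simp: justified_simps)
      show ?case using Suc.IH[OF v(1)] PrimRec.IH(2)[OF v(2)] by simp
    qed
    then show ?case using PrimRec.prems x by blast
  next
    case (Mu f)
    from J[OF Mu.prems] have 0: "run {} f (pair x y) = Some 0"
      and *: "\<forall>m<y. \<exists>v>0. run {} f (pair x m) = Some v"
      using Mu.IH by (simp_all add: justified_simps) blast
    have "(LEAST n. run {} f (pair x n) = Some 0 \<and> (\<forall>m<n. \<exists>v>0. run {} f (pair x m) = Some v)) = y"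
    proof (rule Least_equality)
      show "y \<le> n" if "run {} f (pair x n) = Some 0 \<and> (\<forall>m<n. \<exists>v>0. run {} f (pair x m) = Some v)" for n
      proof (rule ccontr)
        assume "\<not> y \<le> n"
        then have "n < y" by simp
        then obtain v where "v > 0" "run {} f (pair x n) = Some v" using * by blast
        then show False using that by simp
      qed
    qed (use 0 * in simp)
    moreover have "\<exists>n. run {} f (pair x n) = Some 0 \<and> (\<forall>m<n. \<exists>v>0. run {} f (pair x m) = Some v)"
      using 0 * by blast
    ultimately show ?case by (simp only: run.simps Let_def if_True)
  }
qed

definition derivable :: "nat \<Rightarrow> bool" where
  "derivable c \<longleftrightarrow> (\<exists>S. finite S \<and> derivation S \<and> c \<in> S)"

text \<open>Justification is monotone in the set of premises, so derivations of the premises can be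
  merged and the conclusion added.\<close>

lemma derivableI:
  assumes Q: "finite Q" "\<And>c. c \<in> Q \<Longrightarrow> derivable c" and J: "justified Q e x y"
  shows "derivable (pair e (pair x y))"
proof -
  obtain S where S: "\<And>c. c \<in> Q \<Longrightarrow> finite (S c) \<and> derivation (S c) \<and> c \<in> S c"
    using Q(2) unfolding derivable_def by metis
  define S' where "S' = insert (pair e (pair x y)) (\<Union>c\<in>Q. S c)"
  have "justified S' (pfst d) (pfst (psnd d)) (psnd (psnd d))" if d: "d \<in> S'" for d
  proof (cases "d = pair e (pair x y)")
    case True
    have "Q \<subseteq> S'" using S by (auto simp: S'_def)
    then show ?thesis using justified_mono[OF J] True by simp
  next
    case False
    then obtain c where c: "c \<in> Q" "d \<in> S c" using d by (auto simp: S'_def)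
    then have "justified (S c) (pfst d) (pfst (psnd d)) (psnd (psnd d))"
      using S by (auto simp: derivation_def)
    moreover have "S c \<subseteq> S'" using c by (auto simp: S'_def)
    ultimately show ?thesis by (rule justified_mono)
  qed
  then have "derivation S'" by (auto simp: derivation_def)
  moreover have "finite S'" using Q(1) S by (auto simp: S'_def)
  ultimately show ?thesis unfolding derivable_def S'_def by blast
qed

lemma derivation_complete: "run {} p x = Some y \<Longrightarrow> derivable (pair (index p) (pair x y))"
proof (induction p arbitrary: x y)
  case (Pairing f g)
  then obtain a b where ab: "run {} f x = Some a" "run {} g x = Some b" "y = pair a b"
    by (auto simp: bind_eq_Some_conv)
  show ?case
    by (rule derivableI[of "{pair (index f) (pair x a), pair (index g) (pair x b)}"])
      (use Pairing.IH ab in \<open>auto simp: justified_simps\<close>)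
next
  case (Comp f g)
  then obtain v where v: "run {} g x = Some v" "run {} f v = Some y"
    by (auto simp: bind_eq_Some_conv)
  show ?case
    by (rule derivableI[of "{pair (index g) (pair x v), pair (index f) (pair v y)}"])
      (use Comp.IH v in \<open>auto simp: justified_simps\<close>)
next
  case (PrimRec f g)
  obtain a k where x: "x = pair a k" by (metis prod_decode_inverse surj_pair)
  have "run {} (PrimRec f g) (pair a k) = Some y
      \<Longrightarrow> derivable (pair (index (PrimRec f g)) (pair (pair a k) y))" for k y
  proof (induction k arbitrary: y)
    case 0
    then show ?case
      by (intro derivableI[of "{pair (index f) (pair a y)}"])
        (use PrimRec.IH(1) in \<open>auto simp: justified_simps\<close>)
  next
    case (Suc k)
    then obtain v where v: "run {} (PrimRec f g) (pair a k) = Some v"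
      "run {} g (pair a (pair k v)) = Some y"
      by (auto simp: bind_eq_Some_conv)
    have "justified {pair (index (PrimRec f g)) (pair (pair a k) v), pair (index g) (pair (pair a (pair k v)) y)}
       (index (PrimRec f g)) (pair a (Suc k)) y"
      by (auto simp: justified_simps)
    then show ?case
      by (rule derivableI[rotated 2]) (use Suc.IH[OF v(1)] PrimRec.IH(2)[OF v(2)] in auto)
  qed
  then show ?case using PrimRec.prems x by blast
next
  case (Mu f)
  define P where "P = (\<lambda>n. run {} f (pair x n) = Some 0 \<and> (\<forall>m<n. \<exists>v>0. run {} f (pair x m) = Some v))"
  have "\<exists>n. P n" "y = (LEAST n. P n)"
    using Mu.prems by (auto simp: P_def Let_def split: if_splits)
  then have "P y" by (metis LeastI)
  then obtain v where v: "\<And>m. m < y \<Longrightarrow> 0 < v m \<and> run {} f (pair x m) = Some (v m)"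
    and y: "run {} f (pair x y) = Some 0" unfolding P_def by metis
  show ?case
    by (rule derivableI[of "insert (pair (index f) (pair (pair x y) 0))
          ((\<lambda>m. pair (index f) (pair (pair x m) (v m))) ` {..<y})"])
      (use Mu.IH v y in \<open>auto simp: justified_simps\<close>)
qed (auto intro!: derivableI[of "{}"] simp: justified_simps)

text \<open>A form of Kleene's T-predicate: the stage bounds the code of a certificate, which makes
  the relation monotone in \<open>s\<close> and decidable by bounded search.\<close>

definition run_within :: "nat \<Rightarrow> nat \<Rightarrow> nat \<Rightarrow> nat \<Rightarrow> bool" where
  "run_within s e x y \<longleftrightarrow>
     (\<exists>T<s. derivation (set_decode T) \<and> pair e (pair x y) \<in> set_decode T)"

lemma run_within_mono: "run_within s e x y \<Longrightarrow> s \<le> s' \<Longrightarrow> run_within s' e x y"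
  unfolding run_within_def by (meson order_less_le_trans)

lemma run_within_iff: "(\<exists>s. run_within s (index p) x y) \<longleftrightarrow> run {} p x = Some y"
proof
  assume "run {} p x = Some y"
  then obtain S where "finite S" "derivation S" "pair (index p) (pair x y) \<in> S"
    using derivation_complete derivable_def by blast
  then have "run_within (Suc (set_encode S)) (index p) x y"
    unfolding run_within_def by (intro exI[of _ "set_encode S"]) simp
  then show "\<exists>s. run_within s (index p) x y" ..
qed (auto simp: run_within_def derivation_sound)

lemma set_decode_less: "c \<in> set_decode T \<Longrightarrow> c < T"
proof -
  assume "c \<in> set_decode T"
  then have "odd (T div 2 ^ c)" by (simp add: set_decode_def)
  then have "0 < T div 2 ^ c" by (rule odd_pos)
  then have "2 ^ c \<le> T" by (simp add: div_greater_zero_iff)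
  then show "c < T" by (meson less_exp order_less_le_trans)
qed

lemma pair_set_decode_less: "pair e (pair x y) \<in> set_decode T \<Longrightarrow> y < T"
  by (meson set_decode_less le_prod_encode_2 order_le_less_trans)

lemma run_within_less: "run_within s e x y \<Longrightarrow> y < s"
  unfolding run_within_def by (meson pair_set_decode_less less_trans)

text \<open>Everything mentioned in \<open>set_decode T\<close> is below \<open>T\<close>, so the
  intermediate values in \<open>justified\<close> can be bounded by \<open>T\<close> and only
  bounded quantifiers remain.\<close>

lemma decidable_derivation [comp_intros]:
  assumes "computable_in A f"
  shows "decidable_in A (\<lambda>x. derivation (set_decode (f x)))"
proof -
  have *: "derivation (set_decode T) \<longleftrightarrow>
    (\<forall>c<T. c \<in> set_decode T \<longrightarrow>
       justified (set_decode T) (pfst c) (pfst (psnd c)) (psnd (psnd c)))" for T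
    unfolding derivation_def using set_decode_less by blast
  have 1: "(\<exists>v. pair e (pair x v) \<in> set_decode T \<and> Q v) \<longleftrightarrow>
     (\<exists>v<T. pair e (pair x v) \<in> set_decode T \<and> Q v)" for e x T Q
    using pair_set_decode_less by blast
  have 2: "(\<exists>v. 0 < v \<and> pair e (pair x v) \<in> set_decode T) \<longleftrightarrow>
     (\<exists>v<T. 0 < v \<and> pair e (pair x v) \<in> set_decode T)" for e x T
    using pair_set_decode_less by blast
  have "decidable_in A (\<lambda>T. derivation (set_decode T))"
    unfolding * justified_def 1 2 by (intro comp_intros)
  then show ?thesis by (rule decidable_comp) (rule assms)
qed

lemma decidable_run_within [comp_intros]:
  assumes "computable_in A s" "computable_in A e" "computable_in A x" "computable_in A y"
  shows "decidable_in A (\<lambda>z. run_within (s z) (e z) (x z) (y z))"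
proof -
  \<comment> \<open>Below a quantifier the parameter turns into \<open>pfst z\<close>, so the
    assumptions are needed in composed form.\<close>
  note [comp_intros] = assms[THEN computable_comp]
  show ?thesis unfolding run_within_def by (intro comp_intros assms)
qed

text \<open>Allows \<open>halted\<close> to be read for every number, without a test for being an
  index.\<close>

lemma index_surj: "\<exists>p. index p = e"
proof (induction e rule: less_induct)
  case (less e)
  show ?case
  proof (cases "e < 5")
    case True
    then consider "e = 0" | "e = 1" | "e = 2" | "e = 3" | "e = 4" by linarith
    then show ?thesis
      by cases (metis index.simps(1), metis index.simps(2), metis index.simps(3), metis index.simps(4),
          metis index.simps(5))
  next
    case False
    define m where "m = (e - 5) div 4"
    have m: "m < e" using False by (auto simp: m_def)
    have "pfst m \<le> m" "psnd m \<le> m"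
      by (metis le_prod_encode_1 prod.collapse prod_decode_inverse, metis le_prod_encode_2 prod.collapse prod_decode_inverse)
    then obtain f g h where fgh: "index f = pfst m" "index g = psnd m" "index h = m"
      using less.IH m by (meson order_le_less_trans)
    have "e = 5 + 4 * m \<or> e = 6 + 4 * m \<or> e = 7 + 4 * m \<or> e = 8 + 4 * m"
      using False unfolding m_def by presburger
    then have "e = index (Pairing f g) \<or> e = index (Comp f g) \<or> e = index (PrimRec f g) \<or> e = index (Mu h)"
      by (simp add: fgh)
    then show ?thesis by metis
  qed
qed

section \<open>The halting problem as a stagewise enumeration\<close>

definition halted :: "nat \<Rightarrow> nat \<Rightarrow> bool" where
  "halted s e \<longleftrightarrow> (\<exists>y<s. run_within s e e y)"

lemma decidable_halted [comp_intros]: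
  assumes "computable_in A s" "computable_in A e"
  shows "decidable_in A (\<lambda>z. halted (s z) (e z))"
proof -
  note [comp_intros] = assms[THEN computable_comp]
  show ?thesis unfolding halted_def by (intro comp_intros assms)
qed

lemma halted_mono: "halted s e \<Longrightarrow> s \<le> s' \<Longrightarrow> halted s' e"
  unfolding halted_def using run_within_mono order_less_le_trans by blast

lemma halted_0 [simp]: "\<not> halted 0 e"
  by (simp add: halted_def)

lemma halting_problem_iff: "e \<in> halting_problem \<longleftrightarrow> (\<exists>s. halted s e)"
proof -
  obtain p where p: "index p = e" using index_surj by blast
  have "e \<in> halting_problem \<longleftrightarrow> (\<exists>q. index q = e \<and> (\<exists>y. run {} q e = Some y))"
    unfolding halting_problem_def by auto
  also have "\<dots> \<longleftrightarrow> (\<exists>q. index q = e \<and> (\<exists>y s. run_within s e e y))"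
    using run_within_iff by metis
  also have "\<dots> \<longleftrightarrow> (\<exists>y s. run_within s e e y)" using p by blast
  also have "\<dots> \<longleftrightarrow> (\<exists>s. halted s e)" unfolding halted_def using run_within_less by blast
  finally show ?thesis .
qed

text \<open>The s-m-n argument: \<open>Comp p (c x)\<close> ignores its input, so its diagonal
  halting question asks whether \<open>p\<close> halts on \<open>x\<close>. The index of the
  constant program \<open>c x\<close> arises by iterating the code of
  \<open>Comp Succ\<close>.\<close>

lemma domain_reducible_to_halting_problem:
  "\<exists>r. (\<forall>A. computable_in A r) \<and> (\<forall>x. r x \<in> halting_problem \<longleftrightarrow> run {} p x \<noteq> None)"
proof -
  define c where "c = (\<lambda>v. ((Comp Succ) ^^ v) Zero)"
  have c: "run {} (c v) x = Some v" for v x by (induction v) (auto simp: c_def)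
  define r where "r = (\<lambda>v. 6 + 4 * pair (index p) (((\<lambda>z. 6 + 4 * pair 1 z) ^^ v) 0))"
  have "index (c v) = ((\<lambda>z. 6 + 4 * pair 1 z) ^^ v) 0" for v by (induction v) (auto simp: c_def)
  then have r: "r v = index (Comp p (c v))" for v by (simp add: r_def)
  have "r x \<in> halting_problem \<longleftrightarrow> run {} p x \<noteq> None" for x
  proof -
    have "r x \<in> halting_problem \<longleftrightarrow> (\<exists>s. halted s (r x))" by (rule halting_problem_iff)
    also have "\<dots> \<longleftrightarrow> (\<exists>y s. run_within s (r x) (r x) y)"
      unfolding halted_def using run_within_less by blast
    also have "\<dots> \<longleftrightarrow> (\<exists>y. run {} (Comp p (c x)) (r x) = Some y)"
      unfolding run_within_iff[symmetric] r by blast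
    finally show ?thesis by (simp add: c)
  qed
  moreover have "computable_in A r" for A
    unfolding r_def by (intro comp_intros computable_funpow)
  ultimately show ?thesis by blast
qed

lemma semidecidable_decidable_in_halting_problem:
  assumes K: "halting_problem \<le>\<^sub>T A" and P: "decidable_in {} (\<lambda>z. P (pfst z) (psnd z))"
  shows "decidable_in A (\<lambda>x. \<exists>s. P x s)"
proof -
  obtain p where "\<forall>x. run {} p x = (if \<exists>n. P x n then Some 0 else None)"
    using partial_search_prog[OF P, of "\<lambda>_ _. 0"] by (auto intro: computable_const)
  moreover obtain r where r: "\<forall>A. computable_in A r" "\<forall>x. r x \<in> halting_problem \<longleftrightarrow> run {} p x \<noteq> None"
    using domain_reducible_to_halting_problem by blast
  ultimately have "(\<exists>s. P x s) \<longleftrightarrow> r x \<in> halting_problem" for x by simp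
  moreover have "decidable_in A (\<lambda>x. x \<in> halting_problem)"
    using K by (simp add: turing_reducible_def decidable_in_def)
  ultimately show ?thesis using decidable_comp[of A "\<lambda>x. x \<in> halting_problem" r] r(1) by simp
qed

text \<open>Post's theorem relative to \<open>A\<close>: a search for a halting stage or a witness
  of non-halting always stops.\<close>

lemma halting_problem_reducibleI:
  assumes P: "decidable_in A (\<lambda>z. P (pfst z) (psnd z))"
    and iff: "\<And>x. x \<notin> halting_problem \<longleftrightarrow> (\<exists>s. P x s)"
  shows "halting_problem \<le>\<^sub>T A"
proof -
  define Q where "Q = (\<lambda>x s. halted s x \<or> P x s)"
  have ex: "\<exists>s. Q x s" for x
    unfolding Q_def using iff halting_problem_iff by metis
  have c: "computable_in A (\<lambda>x. LEAST s. Q x s)"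
    using ex by (intro comp_intros) (auto simp: Q_def intro!: comp_intros P)
  have "x \<in> halting_problem \<longleftrightarrow> halted (LEAST s. Q x s) x" for x
    using LeastI_ex[OF ex[of x]] iff halting_problem_iff unfolding Q_def by metis
  then have "decidable_in A (\<lambda>x. x \<in> halting_problem)"
    using c by (auto intro!: comp_intros)
  then show ?thesis by (simp add: turing_reducible_def decidable_in_def)
qed

section \<open>Binary strings\<close>

lemma string_code_bounds: "2 ^ length xs \<le> Suc (string_code xs)" "Suc (string_code xs) < 2 ^ Suc (length xs)"
  by (induction xs) auto

lemma string_code_inj: "string_code xs = string_code ys \<Longrightarrow> xs = ys"
proof (induction xs arbitrary: ys)
  case Nil
  then show ?case by (cases ys) (auto split: if_splits)
next
  case (Cons a xs)
  then obtain b zs where ys: "ys = b # zs" by (cases ys) (auto split: if_splits)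
  have "a = b \<and> string_code xs = string_code zs"
    using Cons.prems unfolding ys by (auto split: if_splits) presburger+
  then show ?case using Cons.IH ys by auto
qed

lemma string_code_surj: "\<exists>xs. string_code xs = c"
proof (induction c rule: less_induct)
  case (less c)
  show ?case
  proof (cases "c = 0")
    case False
    define b where "b = even c"
    obtain xs where xs: "string_code xs = (c - 1) div 2"
    proof -
      have "(c - 1) div 2 < c" using False by linarith
      then show ?thesis using less.IH that by blast
    qed
    have "string_code (b # xs) = c"
      using False by (auto simp: xs b_def elim!: oddE evenE)
    then show ?thesis by blast
  qed (auto intro: exI[of _ "[]"])
qed

definition str :: "nat \<Rightarrow> bool list" where
  "str c = (THE xs. string_code xs = c)"

lemma str_string_code [simp]: "str (string_code xs) = xs"
  unfolding str_def using string_code_inj by blast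

lemma string_code_str [simp]: "string_code (str c) = c"
  using string_code_surj str_string_code by metis

lemma all_str: "(\<forall>x. P x) \<longleftrightarrow> (\<forall>z. P (str z))"
  by (metis str_string_code)

lemma ex_str: "(\<exists>x. P x) \<longleftrightarrow> (\<exists>z. P (str z))"
  by (metis str_string_code)

lemma length_str_less_iff: "length (str c) < n \<longleftrightarrow> Suc c < 2 ^ n"
proof -
  have b: "2 ^ length (str c) \<le> Suc c" "Suc c < 2 ^ Suc (length (str c))"
    using string_code_bounds[of "str c"] by simp_all
  show ?thesis
  proof
    assume "length (str c) < n"
    then have "(2::nat) ^ Suc (length (str c)) \<le> 2 ^ n" by (intro power_increasing) auto
    then show "Suc c < 2 ^ n" using b(2) by (rule less_le_trans[rotated])
  next
    assume "Suc c < 2 ^ n"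
    then have "(2::nat) ^ length (str c) < 2 ^ n" by (rule le_less_trans[OF b(1)])
    then show "length (str c) < n" by simp
  qed
qed

lemma length_str_eq_iff: "length (str c) = n \<longleftrightarrow> 2 ^ n \<le> Suc c \<and> Suc c < 2 ^ Suc n"
  using length_str_less_iff[of c n] length_str_less_iff[of c "Suc n"] by linarith

text \<open>The first bit is the most significant one, opposite to \<open>string_code\<close>: a
  string stands for a dyadic interval with left end \<open>binary xs / 2 ^ length xs\<close>, and
  prefixes correspond to inclusion.\<close>

definition binary :: "bool list \<Rightarrow> nat" where
  "binary xs = foldl (\<lambda>a b. 2 * a + of_bool b) 0 xs"

lemma foldl_binary: "foldl (\<lambda>a b. 2 * a + of_bool b) a xs = a * 2 ^ length xs + binary xs"
proof (induction xs arbitrary: a)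
  case (Cons b xs)
  have "binary (b # xs) = foldl (\<lambda>a b. 2 * a + of_bool b) (of_bool b) xs"
    unfolding binary_def foldl_Cons by simp
  also have "\<dots> = of_bool b * 2 ^ length xs + binary xs" by (rule Cons.IH)
  finally have "binary (b # xs) = of_bool b * 2 ^ length xs + binary xs" .
  moreover have "foldl (\<lambda>a b. 2 * a + of_bool b) a (b # xs)
      = (2 * a + of_bool b) * 2 ^ length xs + binary xs"
    unfolding foldl_Cons by (rule Cons.IH)
  ultimately show ?case by (simp only: algebra_simps length_Cons power_Suc)
qed (simp add: binary_def)

lemma binary_append: "binary (xs @ ys) = binary xs * 2 ^ length ys + binary ys"
  using foldl_binary[of "binary xs" ys] by (simp add: binary_def)

lemma binary_less: "binary xs < 2 ^ length xs"
proof (induction xs rule: rev_induct)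
  case (snoc b xs)
  have "binary [b] \<le> 1" by (simp add: binary_def)
  moreover have "binary (xs @ [b]) = binary xs * 2 + binary [b]" by (simp add: binary_append)
  ultimately show ?case using snoc.IH by simp
qed (simp add: binary_def)

lemma ex_binary: "v < 2 ^ n \<Longrightarrow> \<exists>xs. length xs = n \<and> binary xs = v"
proof (induction n arbitrary: v)
  case 0
  then show ?case by (simp add: binary_def)
next
  case (Suc n)
  have "v div 2 < 2 ^ n" using Suc.prems by (simp add: less_mult_imp_div_less mult.commute)
  then obtain xs where xs: "length xs = n" "binary xs = v div 2" using Suc.IH by blast
  have "binary (xs @ [odd v]) = v" unfolding binary_append xs by (simp add: binary_def) presburger
  then show ?case using xs by (intro exI[of _ "xs @ [odd v]"]) simp
qed

text \<open>The accumulator holds value, length and the code still to be read. An even nonzero rest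
  has first digit 2, the bit \<open>True\<close>. A rest of 0 is a fixed point, so any number of
  iterations that is at least the length will do.\<close>

definition scan_step :: "nat \<Rightarrow> nat" where
  "scan_step v = (if psnd (psnd v) = 0 then v else
     pair (2 * pfst v + of_bool (psnd (psnd v) mod 2 = 0))
       (pair (Suc (pfst (psnd v))) ((psnd (psnd v) - 1) div 2)))"

definition scan :: "nat \<Rightarrow> nat" where
  "scan c = (scan_step ^^ c) (pair 0 (pair 0 c))"

lemma scan_string_code:
  "scan (string_code xs) = pair (binary xs) (pair (length xs) 0)"
proof -
  have step: "scan_step (pair a (pair l (string_code (b # xs))))
      = pair (2 * a + of_bool b) (pair (Suc l) (string_code xs))" for a l b xs
  proof -
    have "Suc (2 * m) div 2 = m" "Suc (2 * m) mod 2 \<noteq> 0" for m :: nat by simp_all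
    then show ?thesis by (cases b) (simp_all add: scan_step_def)
  qed
  have *: "(scan_step ^^ n) (pair a (pair l (string_code xs)))
      = pair (foldl (\<lambda>a b. 2 * a + of_bool b) a xs) (pair (l + length xs) 0)"
    if "length xs \<le> n" for n a l xs
    using that
  proof (induction n arbitrary: a l xs)
    case (Suc n)
    show ?case
    proof (cases xs)
      case Nil
      have "(scan_step ^^ m) (pair a (pair l 0)) = pair a (pair l 0)" for m
        by (induction m) (simp_all add: scan_step_def)
      from this[of "Suc n"] show ?thesis using Nil by (simp del: funpow.simps)
    next
      case (Cons b ys)
      then show ?thesis using Suc by (simp add: funpow_Suc_right step del: funpow.simps string_code.simps)
    qed
  qed simp
  have "length xs < 2 ^ length xs" by (rule less_exp)
  then have "length xs \<le> string_code xs" using string_code_bounds(1)[of xs] by linarith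
  from *[OF this] show ?thesis by (simp add: scan_def binary_def)
qed

lemma computable_scan [comp_intros]:
  "computable_in A f \<Longrightarrow> computable_in A (\<lambda>x. scan (f x))"
  unfolding scan_def by (intro computable_funpow comp_intros; (unfold scan_step_def, intro comp_intros)?)

lemma prefix_binary:
  assumes "prefix xs ys"
  shows "binary xs * 2 ^ (length ys - length xs) \<le> binary ys"
    "binary ys < Suc (binary xs) * 2 ^ (length ys - length xs)"
proof -
  obtain zs where ys: "ys = xs @ zs" using assms by (auto elim: prefixE)
  show "binary xs * 2 ^ (length ys - length xs) \<le> binary ys"
    "binary ys < Suc (binary xs) * 2 ^ (length ys - length xs)"
    using binary_less[of zs] by (simp_all add: ys binary_append)
qed

section \<open>Kraft's inequality and the Kraft-Chaitin theorem\<close>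

lemma sum_half_powers_le: "finite V \<Longrightarrow> (\<Sum>v\<in>V. (1 / 2) ^ Suc v) \<le> (1 :: real)"
proof -
  assume "finite V"
  then have "(\<Sum>i\<in>V. (1 / 2) ^ Suc i) \<le> (\<Sum>i. (1 / 2 :: real) ^ Suc i)"
    by (intro sum_le_suminf) (use power_half_series in \<open>auto simp: sums_iff\<close>)
  also have "\<dots> = 1" using power_half_series by (simp add: sums_iff)
  finally show ?thesis .
qed

lemma finite_strings: "finite {xs :: bool list. length xs = n}"
  using finite_lists_length_eq[of "UNIV :: bool set" n] by simp

lemma card_strings: "card {xs :: bool list. length xs = n} = 2 ^ n"
  using card_lists_length_eq[of "UNIV :: bool set" n] by simp

text \<open>Extend all strings to a common length: incomparable strings have disjoint sets of
  extensions.\<close>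

lemma kraft_inequality:
  fixes S :: "bool list set"
  assumes fin: "finite S" and pf: "\<And>\<sigma> \<tau>. \<sigma> \<in> S \<Longrightarrow> \<tau> \<in> S \<Longrightarrow> prefix \<sigma> \<tau> \<Longrightarrow> \<sigma> = \<tau>"
  shows "(\<Sum>\<sigma>\<in>S. (1 / 2) ^ length \<sigma>) \<le> (1 :: real)"
proof -
  define L where "L = Max (insert 0 (length ` S))"
  have L: "length \<sigma> \<le> L" if "\<sigma> \<in> S" for \<sigma>
    using fin that by (auto simp: L_def intro: Max_ge)
  define ext where "ext = (\<lambda>\<sigma> :: bool list. (\<lambda>ys. \<sigma> @ ys) ` {ys. length ys = L - length \<sigma>})"
  have card_ext: "card (ext \<sigma>) = 2 ^ (L - length \<sigma>)" for \<sigma>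
    unfolding ext_def by (subst card_image) (auto simp: inj_on_def card_strings)
  have "(\<Sum>\<sigma>\<in>S. card (ext \<sigma>)) = card (\<Union>\<sigma>\<in>S. ext \<sigma>)"
  proof (rule card_UN_disjoint[symmetric, OF fin])
    show "\<forall>\<sigma>\<in>S. finite (ext \<sigma>)" by (simp add: ext_def finite_strings)
    show "\<forall>\<sigma>\<in>S. \<forall>\<tau>\<in>S. \<sigma> \<noteq> \<tau> \<longrightarrow> ext \<sigma> \<inter> ext \<tau> = {}"
    proof (intro ballI impI)
      fix \<sigma> \<tau> assume st: "\<sigma> \<in> S" "\<tau> \<in> S" "\<sigma> \<noteq> \<tau>"
      have "\<not> (prefix \<sigma> \<rho> \<and> prefix \<tau> \<rho>)" for \<rho>
        using st pf by (metis prefix_same_cases)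
      then show "ext \<sigma> \<inter> ext \<tau> = {}" unfolding ext_def by (auto, metis prefixI)
    qed
  qed
  also have "\<dots> \<le> card {xs :: bool list. length xs = L}"
    by (rule card_mono[OF finite_strings]) (auto simp: ext_def L)
  finally have "(\<Sum>\<sigma>\<in>S. 2 ^ (L - length \<sigma>)) \<le> (2 ^ L :: nat)"
    unfolding card_ext card_strings .
  then have "real (\<Sum>\<sigma>\<in>S. 2 ^ (L - length \<sigma>)) \<le> real (2 ^ L)" using of_nat_le_iff by blast
  then have "(\<Sum>\<sigma>\<in>S. 2 ^ (L - length \<sigma>)) \<le> (2 ^ L :: real)" by simp
  moreover have "(\<Sum>\<sigma>\<in>S. 2 ^ (L - length \<sigma>)) = 2 ^ L * (\<Sum>\<sigma>\<in>S. (1 / 2 :: real) ^ length \<sigma>)"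
    unfolding sum_distrib_left
  proof (rule sum.cong)
    fix \<sigma> assume "\<sigma> \<in> S"
    then show "(2::real) ^ (L - length \<sigma>) = 2 ^ L * (1 / 2) ^ length \<sigma>"
      using L by (simp add: power_diff power_divide)
  qed simp
  ultimately show ?thesis by simp
qed

text \<open>
  Requests are served in order of arrival: a request of length \<open>l\<close> gets the fresh interval
  \<open>[s, s + 2\<^sup>-\<^sup>l)\<close> of the unit interval, which contains an aligned dyadic interval of length
  \<open>2\<^sup>-\<^sup>l\<^sup>-\<^sup>1\<close>. The left end \<open>s\<close> is kept as a fraction of two natural numbers.
\<close>

lemma kraft_chaitin_machine:
  fixes fire :: "nat \<Rightarrow> bool" and l x :: "nat \<Rightarrow> nat"
  assumes fire: "decidable_in {} fire" and l: "computable_in {} l" and x: "computable_in {} x"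
    and weight: "\<And>n. (\<Sum>m | m < n \<and> fire m. (1 / 2) ^ l m) \<le> (1 :: real)"
  shows "\<exists>M. prefix_free_machine M \<and>
    (\<forall>m. fire m \<longrightarrow> (\<exists>\<sigma>. M \<sigma> = Some (str (x m)) \<and> length \<sigma> = Suc (l m)))"
proof -
  \<comment> \<open>Numerator and denominator of the left end \<open>s m\<close>; multiplying by
    \<open>2 ^ l m\<close> avoids reducing fractions.\<close>
  define SE where "SE = (\<lambda>m. rec_nat (pair 0 1)
    (\<lambda>m v. if fire m then pair (pfst v * 2 ^ l m + psnd v) (psnd v * 2 ^ l m) else v) m)"
  define S where "S = (\<lambda>m. pfst (SE m))"
  define E where "E = (\<lambda>m. psnd (SE m))"
  define s where "s = (\<lambda>n. \<Sum>m | m < n \<and> fire m. (1 / 2 :: real) ^ l m)"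
  have s_Suc: "s (Suc n) = s n + (if fire n then (1 / 2) ^ l n else 0)" for n
  proof -
    have "{m. m < Suc n \<and> fire m} = (if fire n then insert n {m. m < n \<and> fire m} else {m. m < n \<and> fire m})"
      by (auto simp: less_Suc_eq)
    then show ?thesis by (simp add: s_def)
  qed
  have SE: "0 < E m \<and> real (S m) = s m * real (E m)" for m
  proof (induction m)
    case 0
    then show ?case by (simp add: S_def E_def SE_def s_def)
  next
    case (Suc m)
    have "SE (Suc m) = (if fire m then pair (S m * 2 ^ l m + E m) (E m * 2 ^ l m) else SE m)"
      by (simp add: S_def E_def SE_def)
    then have "S (Suc m) = (if fire m then S m * 2 ^ l m + E m else S m)"
      "E (Suc m) = (if fire m then E m * 2 ^ l m else E m)"
      by (auto simp: S_def E_def)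
    then show ?case using Suc by (simp add: s_Suc field_simps)
  qed
  have s_mono: "s m + (1 / 2) ^ l m \<le> s m'" if "m < m'" "fire m" for m m'
    using \<open>m < m'\<close>
  proof (induction m')
    case (Suc m')
    have "s m' \<le> s (Suc m')" by (simp add: s_Suc)
    then show ?case using Suc \<open>fire m\<close> by (cases "m = m'") (auto simp: s_Suc)
  qed simp
  \<comment> \<open>With denominators cleared: the left end of the string's interval lies in
    \<open>[s m, s m + 2^-L)\<close> for \<open>L = Suc (l m)\<close>, which singles out one string
    of length \<open>L\<close>.\<close>
  define match where "match = (\<lambda>c m. fire m \<and> pfst (psnd (scan c)) = Suc (l m) \<and>
    S m * 2 ^ Suc (l m) \<le> pfst (scan c) * E m \<and> pfst (scan c) * E m < S m * 2 ^ Suc (l m) + E m)"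
  have match: "match (string_code \<sigma>) m \<longleftrightarrow> fire m \<and> length \<sigma> = Suc (l m) \<and>
    s m \<le> binary \<sigma> / 2 ^ length \<sigma> \<and> binary \<sigma> / 2 ^ length \<sigma> < s m + (1 / 2) ^ length \<sigma>" for \<sigma> m
  proof -
    have E: "0 < real (E m)" using SE by simp
    have A: "S m * 2 ^ L \<le> v * E m \<longleftrightarrow> s m \<le> v / 2 ^ L" for v L
    proof -
      have "S m * 2 ^ L \<le> v * E m \<longleftrightarrow> real (S m * 2 ^ L) \<le> real (v * E m)" by (simp only: of_nat_le_iff)
      also have "\<dots> \<longleftrightarrow> (s m * 2 ^ L) * real (E m) \<le> v * real (E m)" using SE by (simp add: mult_ac)
      also have "\<dots> \<longleftrightarrow> s m * 2 ^ L \<le> v" using E by simp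
      finally show ?thesis by (simp add: field_simps)
    qed
    have B: "v * E m < S m * 2 ^ L + E m \<longleftrightarrow> v / 2 ^ L < s m + (1 / 2) ^ L" for v L
    proof -
      have "v * E m < S m * 2 ^ L + E m \<longleftrightarrow> real (v * E m) < real (S m * 2 ^ L + E m)"
        by (simp only: of_nat_less_iff)
      also have "\<dots> \<longleftrightarrow> v * real (E m) < (s m * 2 ^ L + 1) * real (E m)"
        using SE by (simp add: algebra_simps)
      also have "\<dots> \<longleftrightarrow> v < s m * 2 ^ L + 1" using E by simp
      finally show ?thesis by (simp add: field_simps power_divide)
    qed
    show ?thesis
      unfolding match_def scan_string_code by (auto simp: A B simp del: power_Suc)
  qed
  \<comment> \<open>Comparable strings have nested intervals, whereas the ranges reserved for
    different requests are disjoint. This yields prefix-freeness and, for equal strings, an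
    unambiguous output.\<close>
  have unique: "m = m'"
    if m: "match (string_code \<sigma>) m" and m': "match (string_code \<tau>) m'" and pre: "prefix \<sigma> \<tau>" for \<sigma> \<tau> m m'
  proof -
    have len: "length \<sigma> \<le> length \<tau>" using pre by (rule prefix_length_le)
    define d where "d = length \<tau> - length \<sigma>"
    have d: "(2::real) ^ length \<tau> = 2 ^ length \<sigma> * 2 ^ d" using len by (simp add: d_def flip: power_add)
    have "real (binary \<sigma> * 2 ^ d) \<le> real (binary \<tau>)"
      and "real (Suc (binary \<tau>)) \<le> real (Suc (binary \<sigma>) * 2 ^ d)"
      using prefix_binary[OF pre] unfolding d_def of_nat_le_iff by simp_all
    then have "binary \<sigma> * 2 ^ d / 2 ^ length \<tau> \<le> binary \<tau> / 2 ^ length \<tau>"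
      and "(binary \<tau> + 1) / 2 ^ length \<tau> \<le> (binary \<sigma> + 1) * 2 ^ d / 2 ^ length \<tau>"
      by (simp_all add: divide_right_mono algebra_simps)
    then have lo: "binary \<sigma> / 2 ^ length \<sigma> \<le> binary \<tau> / 2 ^ length \<tau>"
      and hi: "binary \<tau> / 2 ^ length \<tau> + (1 / 2) ^ length \<tau> \<le> binary \<sigma> / 2 ^ length \<sigma> + (1 / 2) ^ length \<sigma>"
      by (simp_all add: d power_divide add_divide_distrib)
    have half: "(1 / 2 :: real) ^ l m = 2 * (1 / 2) ^ length \<sigma>" "(1 / 2 :: real) ^ l m' = 2 * (1 / 2) ^ length \<tau>"
      using m m' unfolding match by simp_all
    have pos: "(1 / 2 :: real) ^ length \<tau> > 0" by simp
    show "m = m'"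
    proof (rule linorder_cases[of m m'])
      assume "m < m'"
      then have "s m + 2 * (1 / 2) ^ length \<sigma> \<le> s m'" using s_mono half m match by metis
      then show ?thesis using m m' hi pos unfolding match by linarith
    next
      assume "m' < m"
      then have "s m' + 2 * (1 / 2) ^ length \<tau> \<le> s m" using s_mono half m' match by metis
      then show ?thesis using m m' lo pos unfolding match by linarith
    qed
  qed
  define M where "M = (\<lambda>\<sigma>. if \<exists>m. match (string_code \<sigma>) m
    then Some (str (x (LEAST m. match (string_code \<sigma>) m))) else None)"
  have M: "M \<sigma> = Some (str (x m))" if "match (string_code \<sigma>) m" for \<sigma> m
  proof -
    have "(LEAST m. match (string_code \<sigma>) m) = m"
      using unique[OF LeastI[of "match (string_code \<sigma>)", OF that] that] by simp
    then show ?thesis using that by (auto simp: M_def)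
  qed
  have "prefix_free_machine M"
    unfolding prefix_free_machine_def
  proof (intro conjI ballI impI)
    note [comp_intros] = decidable_comp[OF fire] computable_comp[OF l] computable_comp[OF x]
    have "computable_in {} SE" unfolding SE_def by (intro comp_intros)
    note [comp_intros] = computable_comp[OF this]
    have dm: "decidable_in {} (\<lambda>z. match (pfst z) (psnd z))"
      unfolding match_def S_def E_def by (intro comp_intros)
    have dx: "computable_in {} (\<lambda>z. x (psnd z))" by (intro comp_intros)
    obtain p where p: "\<forall>c. run {} p c = (if \<exists>m. match c m then Some (x (LEAST m. match c m)) else None)"
      using partial_search_prog[OF dm dx] by blast
    have "run {} p (string_code \<sigma>) = map_option string_code (M \<sigma>)" for \<sigma>
      unfolding p[rule_format] M_def by simp
    then show "\<exists>p. \<forall>\<sigma>. run {} p (string_code \<sigma>) = map_option string_code (M \<sigma>)" by blast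
  next
    fix \<sigma> \<tau> assume "\<sigma> \<in> dom M" "\<tau> \<in> dom M" and pre: "prefix \<sigma> \<tau>"
    then obtain m m' where mm: "match (string_code \<sigma>) m" "match (string_code \<tau>) m'"
      by (auto simp: M_def split: if_splits)
    then have "m = m'" using unique pre by blast
    then have "length \<sigma> = length \<tau>" using mm by (simp add: match)
    then show "\<sigma> = \<tau>" using pre by (auto elim: prefixE)
  qed
  moreover have "\<exists>\<sigma>. M \<sigma> = Some (str (x m)) \<and> length \<sigma> = Suc (l m)" if f: "fire m" for m
  proof -
    define L where "L = Suc (l m)"
    \<comment> \<open>Rounding up to a multiple of \<open>2^-L\<close> loses less than
      \<open>2^-L\<close>, while the request owns \<open>2 * 2^-L\<close>, so the string stays
      inside the unit interval.\<close>
    define v where "v = nat \<lceil>s m * 2 ^ L\<rceil>"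
    have s0: "0 \<le> s m" by (auto simp: s_def intro: sum_nonneg)
    have v: "s m * 2 ^ L \<le> real v" "real v < s m * 2 ^ L + 1"
      using s0 unfolding v_def by (auto simp: of_nat_nat) linarith+
    have "s m + (1 / 2) ^ l m \<le> 1" using weight[of "Suc m"] f s_Suc[of m] by (simp add: s_def)
    then have "(s m + (1 / 2) ^ l m) * 2 ^ L \<le> 1 * 2 ^ L" by (intro mult_right_mono) auto
    moreover have "(1 / 2) ^ l m * 2 ^ L = (2::real)" by (simp add: L_def power_divide)
    ultimately have "s m * 2 ^ L + 2 \<le> 2 ^ L" by (simp add: distrib_right)
    then have "real v < 2 ^ L" using v by linarith
    then have "v < 2 ^ L" by simp
    then obtain \<sigma> where \<sigma>: "length \<sigma> = L" "binary \<sigma> = v" using ex_binary by blast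
    have "match (string_code \<sigma>) m"
      using v f unfolding match \<sigma> by (simp add: L_def[symmetric] field_simps power_divide)
    then show ?thesis using M \<sigma> L_def by blast
  qed
  ultimately show ?thesis by blast
qed

locale universal_machine =
  fixes U :: "bool list \<Rightarrow> bool list option"
  assumes universal: "universal_prefix_free_machine U"
begin

lemma prefix_free_U: "U \<sigma> = Some x \<Longrightarrow> U \<tau> = Some y \<Longrightarrow> prefix \<sigma> \<tau> \<Longrightarrow> \<sigma> = \<tau>"
  using universal unfolding universal_prefix_free_machine_def prefix_free_machine_def by blast

text \<open>Kraft-Chaitin: request \<open>i\<close> is the string with code \<open>x i\<close> at length \<open>l i\<close>, issued when \<open>E t i\<close> first holds.\<close>

lemma kraft_chaitin:
  fixes E :: "nat \<Rightarrow> nat \<Rightarrow> bool" and l x :: "nat \<Rightarrow> nat"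
  assumes E: "decidable_in {} (\<lambda>z. E (pfst z) (psnd z))" and l: "computable_in {} l" and x: "computable_in {} x"
    and weight: "\<And>I. finite I \<Longrightarrow> (\<And>i. i \<in> I \<Longrightarrow> \<exists>t. E t i) \<Longrightarrow> (\<Sum>i\<in>I. (1 / 2) ^ l i) \<le> (1 :: real)"
  shows "\<exists>c. \<forall>i. (\<exists>t. E t i) \<longrightarrow> (\<exists>\<tau>. U \<tau> = Some (str (x i)) \<and> length \<tau> \<le> l i + c)"
proof -
  \<comment> \<open>\<open>m\<close> codes a stage and a request; only the first stage fires, so
    that no request is weighed twice.\<close>
  define fire where "fire = (\<lambda>m. E (pfst m) (psnd m) \<and> (\<forall>t<pfst m. \<not> E t (psnd m)))"
  have "decidable_in {} (\<lambda>z. E (psnd z) (psnd (pfst z)))"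
    using decidable_comp[OF E, of "\<lambda>z. pair (psnd z) (psnd (pfst z))"] by (simp add: comp_intros)
  then have fire: "decidable_in {} fire"
    unfolding fire_def by (intro comp_intros E)
  have inj: "inj_on psnd {m. fire m}"
  proof (rule inj_onI)
    fix a b assume ab: "a \<in> {m. fire m}" "b \<in> {m. fire m}" "psnd a = psnd b"
    then have "pfst a = pfst b" unfolding fire_def by (metis (lifting) linorder_neqE_nat mem_Collect_eq)
    then show "a = b" using ab by (metis prod.collapse prod_decode_inverse)
  qed
  have "\<exists>M. prefix_free_machine M \<and>
    (\<forall>m. fire m \<longrightarrow> (\<exists>\<sigma>. M \<sigma> = Some (str (x (psnd m))) \<and> length \<sigma> = Suc (l (psnd m))))"
  proof (rule kraft_chaitin_machine[OF fire])
    show "computable_in {} (\<lambda>m. l (psnd m))" "computable_in {} (\<lambda>m. x (psnd m))"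
      by (intro computable_comp[OF l] computable_comp[OF x] comp_intros)+
    fix n
    have "(\<Sum>m | m < n \<and> fire m. (1 / 2) ^ l (psnd m)) = (\<Sum>i\<in>psnd ` {m. m < n \<and> fire m}. (1 / 2 :: real) ^ l i)"
      by (subst sum.reindex) (auto intro: inj_on_subset[OF inj])
    also have "\<dots> \<le> 1" by (rule weight) (auto simp: fire_def)
    finally show "(\<Sum>m | m < n \<and> fire m. (1 / 2) ^ l (psnd m)) \<le> (1 :: real)" .
  qed
  then obtain M where M: "prefix_free_machine M"
    "\<And>m. fire m \<Longrightarrow> \<exists>\<sigma>. M \<sigma> = Some (str (x (psnd m))) \<and> length \<sigma> = Suc (l (psnd m))" by blast
  obtain c where c: "\<And>\<sigma>. \<sigma> \<in> dom M \<Longrightarrow> \<exists>\<tau>. U \<tau> = M \<sigma> \<and> length \<tau> \<le> length \<sigma> + c"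
    using universal M(1) unfolding universal_prefix_free_machine_def by blast
  have "\<exists>\<tau>. U \<tau> = Some (str (x i)) \<and> length \<tau> \<le> l i + Suc c" if ex: "\<exists>t. E t i" for i
  proof -
    obtain t where "E t i" "\<forall>t'<t. \<not> E t' i"
      using ex exists_least_iff[of "\<lambda>t. E t i"] by blast
    then have "fire (pair t i)" by (simp add: fire_def)
    from M(2)[OF this] obtain \<sigma> where \<sigma>: "M \<sigma> = Some (str (x i))" "length \<sigma> = Suc (l i)" by auto
    then have "\<sigma> \<in> dom M" by blast
    from c[OF this] obtain \<tau> where "U \<tau> = M \<sigma>" "length \<tau> \<le> length \<sigma> + c" by blast
    then have "U \<tau> = Some (str (x i))" "length \<tau> \<le> l i + Suc c" using \<sigma> by simp_all
    then show ?thesis by blast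
  qed
  then show ?thesis by blast
qed

section \<open>Complexities approximated from above by stages, and counting of lengths\<close>

definition U_index :: nat where
  "U_index = index (SOME p. \<forall>\<sigma>. run {} p (string_code \<sigma>) = map_option string_code (U \<sigma>))"

lemma run_within_U: "(\<exists>s. run_within s U_index c z) \<longleftrightarrow> U (str c) = Some (str z)"
proof -
  define p where "p = (SOME p. \<forall>\<sigma>. run {} p (string_code \<sigma>) = map_option string_code (U \<sigma>))"
  have "\<exists>p. \<forall>\<sigma>. run {} p (string_code \<sigma>) = map_option string_code (U \<sigma>)"
    using universal unfolding universal_prefix_free_machine_def prefix_free_machine_def by blast
  then have "\<forall>\<sigma>. run {} p (string_code \<sigma>) = map_option string_code (U \<sigma>)"
    unfolding p_def by (rule someI_ex)
  then have "run {} p c = map_option string_code (U (str c))" by (metis string_code_str)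
  then have "run {} p c = Some z \<longleftrightarrow> U (str c) = Some (str z)"
    by (cases "U (str c)") (simp_all, metis str_string_code string_code_str)
  then show ?thesis unfolding U_index_def p_def[symmetric] run_within_iff .
qed

text \<open>\<open>Suc c < 2 ^ Suc L\<close> says that the string with code \<open>c\<close> has
  length at most \<open>L\<close>; the bound on \<open>c\<close> itself makes the quantifier
  bounded.\<close>

definition short :: "nat \<Rightarrow> nat \<Rightarrow> nat \<Rightarrow> bool" where
  "short s z L \<longleftrightarrow> (\<exists>c<2 ^ Suc L. Suc c < 2 ^ Suc L \<and> run_within s U_index c z)"

definition full :: "nat \<Rightarrow> nat \<Rightarrow> nat \<Rightarrow> bool" where
  "full s N L \<longleftrightarrow> (\<forall>z<2 ^ Suc N. 2 ^ N \<le> Suc z \<and> Suc z < 2 ^ Suc N \<longrightarrow> short s z L)"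

lemma decidable_short [comp_intros]:
  assumes "computable_in A s" "computable_in A z" "computable_in A L"
  shows "decidable_in A (\<lambda>v. short (s v) (z v) (L v))"
proof -
  note [comp_intros] = assms[THEN computable_comp]
  show ?thesis unfolding short_def by (intro comp_intros assms)
qed

lemma decidable_full [comp_intros]:
  assumes "computable_in A s" "computable_in A N" "computable_in A L"
  shows "decidable_in A (\<lambda>v. full (s v) (N v) (L v))"
proof -
  note [comp_intros] = assms[THEN computable_comp]
  show ?thesis unfolding full_def by (intro comp_intros assms)
qed

lemma short_mono:
  assumes "short s z L" "s \<le> s'" "L \<le> L'"
  shows "short s' z L'"
proof -
  obtain c where c: "Suc c < 2 ^ Suc L" "run_within s U_index c z"
    using assms(1) unfolding short_def by blast
  have "(2::nat) ^ Suc L \<le> 2 ^ Suc L'" using assms(3) by (intro power_increasing) auto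
  then have "Suc c < 2 ^ Suc L'" using c(1) by (rule less_le_trans[rotated])
  moreover have "run_within s' U_index c z" using c(2) assms(2) by (rule run_within_mono)
  ultimately show ?thesis unfolding short_def by (intro exI[of _ c]) simp
qed

lemma full_mono: "full s N L \<Longrightarrow> s \<le> s' \<Longrightarrow> L \<le> L' \<Longrightarrow> full s' N L'"
  unfolding full_def using short_mono by blast

lemma short_iff: "(\<exists>s. short s z L) \<longleftrightarrow> (\<exists>\<tau>. U \<tau> = Some (str z) \<and> length \<tau> \<le> L)"
proof -
  have "(\<exists>s. short s z L) \<longleftrightarrow> (\<exists>c. Suc c < 2 ^ Suc L \<and> (\<exists>s. run_within s U_index c z))"
    unfolding short_def using Suc_lessD by blast
  also have "\<dots> \<longleftrightarrow> (\<exists>c. length (str c) \<le> L \<and> U (str c) = Some (str z))"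
    unfolding run_within_U length_str_less_iff[symmetric] less_Suc_eq_le ..
  also have "\<dots> \<longleftrightarrow> (\<exists>\<tau>. U \<tau> = Some (str z) \<and> length \<tau> \<le> L)"
    using ex_str[of "\<lambda>\<tau>. length \<tau> \<le> L \<and> U \<tau> = Some (str z)"] by blast
  finally show ?thesis .
qed

lemma prefix_complexity_le_iff:
  "prefix_complexity U x \<le> enat L \<longleftrightarrow> (\<exists>\<tau>. U \<tau> = Some x \<and> length \<tau> \<le> L)"
proof
  assume *: "prefix_complexity U x \<le> enat L"
  define S where "S = {enat (length \<sigma>) | \<sigma>. U \<sigma> = Some x}"
  have le: "Inf S \<le> enat L" using * by (simp add: prefix_complexity_def S_def)
  have "S \<noteq> {}"
  proof
    assume "S = {}"
    then show False using le by (simp add: Inf_enat_def)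
  qed
  then obtain e where "e \<in> S" by blast
  then have "(LEAST e. e \<in> S) \<in> S" by (rule LeastI[of "\<lambda>e. e \<in> S"])
  then have "Inf S \<in> S" using \<open>S \<noteq> {}\<close> by (simp add: Inf_enat_def)
  then obtain \<sigma> where "Inf S = enat (length \<sigma>)" "U \<sigma> = Some x" unfolding S_def by blast
  then show "\<exists>\<tau>. U \<tau> = Some x \<and> length \<tau> \<le> L" using le by auto
next
  assume "\<exists>\<tau>. U \<tau> = Some x \<and> length \<tau> \<le> L"
  then obtain \<tau> where "U \<tau> = Some x" "length \<tau> \<le> L" by blast
  then have "prefix_complexity U x \<le> enat (length \<tau>)"
    unfolding prefix_complexity_def by (intro Inf_lower) blast
  then show "prefix_complexity U x \<le> enat L" using \<open>length \<tau> \<le> L\<close> by (meson enat_ord_simps(1) order_trans)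
qed

lemma full_iff: "(\<exists>s. full s N L) \<longleftrightarrow> (\<forall>x. length x = N \<longrightarrow> prefix_complexity U x \<le> enat L)"
proof -
  have "(\<exists>s. full s N L) \<longleftrightarrow> (\<forall>z<2 ^ Suc N. 2 ^ N \<le> Suc z \<and> Suc z < 2 ^ Suc N \<longrightarrow> (\<exists>s. short s z L))"
  proof
    assume *: "\<forall>z<2 ^ Suc N. 2 ^ N \<le> Suc z \<and> Suc z < 2 ^ Suc N \<longrightarrow> (\<exists>s. short s z L)"
    then obtain s where s: "\<And>z. 2 ^ N \<le> Suc z \<and> Suc z < 2 ^ Suc N \<Longrightarrow> short (s z) z L"
      by (metis Suc_lessD)
    have "full (Max (s ` {..<2 ^ Suc N})) N L"
      unfolding full_def by (auto intro!: short_mono[OF s] Max_ge)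
    then show "\<exists>s. full s N L" ..
  qed (auto simp: full_def)
  also have "\<dots> \<longleftrightarrow> (\<forall>z. length (str z) = N \<longrightarrow> prefix_complexity U (str z) \<le> enat L)"
    unfolding short_iff prefix_complexity_le_iff length_str_eq_iff using Suc_lessD by blast
  also have "\<dots> \<longleftrightarrow> (\<forall>x. length x = N \<longrightarrow> prefix_complexity U x \<le> enat L)"
    by (rule all_str[symmetric])
  finally show ?thesis .
qed

text \<open>Kraft's inequality for the domain of \<open>U\<close>: the strings with lengths in
  \<open>R\<close> have distinct programs, and length \<open>N\<close> contributes
  \<open>2 ^ N\<close> of them, each no longer than \<open>L N\<close>.\<close>

lemma full_weight:
  assumes fin: "finite R" and full: "\<And>N. N \<in> R \<Longrightarrow> \<exists>s. full s N (L N)"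
  shows "(\<Sum>N\<in>R. 2 ^ N * (1 / 2) ^ L N) \<le> (1 :: real)"
proof -
  define X where "X = (\<Union>N\<in>R. {x :: bool list. length x = N})"
  have finX: "finite X" using fin finite_strings by (simp add: X_def)
  have "\<exists>\<tau>. U \<tau> = Some x \<and> length \<tau> \<le> L (length x)" if "x \<in> X" for x
    using full[of "length x"] that unfolding full_iff prefix_complexity_le_iff X_def by auto
  then obtain g where g: "\<And>x. x \<in> X \<Longrightarrow> U (g x) = Some x" "\<And>x. x \<in> X \<Longrightarrow> length (g x) \<le> L (length x)"
    by metis
  have inj: "inj_on g X" by (rule inj_onI) (metis g(1) option.inject)
  have "(\<Sum>N\<in>R. 2 ^ N * (1 / 2) ^ L N) = (\<Sum>N\<in>R. \<Sum>x | length (x :: bool list) = N. (1 / 2 :: real) ^ L (length x))"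
    by (simp add: card_strings)
  also have "\<dots> = (\<Sum>x\<in>X. (1 / 2) ^ L (length x))"
    unfolding X_def by (rule sum.UNION_disjoint[symmetric]) (use fin finite_strings in auto)
  also have "\<dots> \<le> (\<Sum>x\<in>X. (1 / 2) ^ length (g x))"
    by (intro sum_mono power_decreasing g) auto
  also have "\<dots> = (\<Sum>\<sigma>\<in>g ` X. (1 / 2) ^ length \<sigma>)"
    by (simp add: sum.reindex[OF inj])
  also have "\<dots> \<le> 1"
  proof (rule kraft_inequality)
    show "\<sigma> = \<tau>" if "\<sigma> \<in> g ` X" "\<tau> \<in> g ` X" "prefix \<sigma> \<tau>" for \<sigma> \<tau>
      using that g(1) prefix_free_U by blast
  qed (simp add: finX)
  finally show ?thesis .
qed

lemma full_ge: "full s N L \<Longrightarrow> N \<le> L"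
proof -
  assume "full s N L"
  then have "(2::real) ^ N * (1 / 2) ^ L \<le> 1" using full_weight[of "{N}" "\<lambda>_. L"] by auto
  then have "(2::real) ^ N \<le> 2 ^ L" by (simp add: field_simps power_divide)
  then show "N \<le> L" by simp
qed

lemma card_full_le:
  assumes fin: "finite R" and full: "\<And>N. N \<in> R \<Longrightarrow> \<exists>s. full s N (N + m)"
  shows "card R \<le> 2 ^ m"
proof -
  have "(\<Sum>N\<in>R. 2 ^ N * (1 / 2) ^ (N + m)) \<le> (1 :: real)" by (rule full_weight[OF fin full])
  moreover have "(2::real) ^ N * (1 / 2) ^ (N + m) = (1 / 2) ^ m" for N
    by (simp add: power_add power_divide)
  ultimately have "real (card R) \<le> real (2 ^ m)" by (simp add: field_simps power_divide)
  then show ?thesis by (simp only: of_nat_le_iff)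
qed

text \<open>Requesting the string with code \<open>i\<close> at length \<open>i + 1\<close> has
  total weight at most 1, so every string gets some program.\<close>

lemma prefix_complexity_finite: "\<exists>L. prefix_complexity U x \<le> enat L"
proof -
  have "\<exists>c. \<forall>i. (\<exists>t :: nat. True) \<longrightarrow> (\<exists>\<tau>. U \<tau> = Some (str i) \<and> length \<tau> \<le> Suc i + c)"
    by (intro kraft_chaitin[of "\<lambda>_ _. True" Suc "\<lambda>i. i"] decidable_const computable_Suc computable_id sum_half_powers_le)
  then obtain c where "\<And>i. \<exists>\<tau>. U \<tau> = Some (str i) \<and> length \<tau> \<le> Suc i + c" by auto
  from this[of "string_code x"] show ?thesis
    unfolding prefix_complexity_le_iff by auto
qed

lemma full_ex: "\<exists>s L. full s N L"
proof -
  obtain f where f: "\<And>x. prefix_complexity U x \<le> enat (f x)" using prefix_complexity_finite by metis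
  have "\<forall>x. length x = N \<longrightarrow> prefix_complexity U x \<le> enat (Max (f ` {x. length x = N}))"
    using f finite_strings by (auto intro!: order_trans[OF f] Max_ge)
  then show ?thesis using full_iff by blast
qed

end

section \<open>Strings of maximal complexity from the halting problem\<close>

context universal_machine
begin

lemma short_iff_prefix_complexity:
  "(\<exists>s. short s z L) \<longleftrightarrow> prefix_complexity U (str z) \<le> enat L"
  by (simp add: short_iff prefix_complexity_le_iff)

lemma maximal_complexity_computable:
  assumes K: "halting_problem \<le>\<^sub>T A"
  shows "\<exists>F. string_fun_computable_in A F \<and>
    (\<forall>n. \<forall>x. length x = n \<longrightarrow>
      length (F n) = n \<and> prefix_complexity U x \<le> prefix_complexity U (F n))"
proof -
  define D where "D = (\<lambda>v. \<exists>s. short s (pfst v) (psnd v))"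
  have D: "D (pair z L) \<longleftrightarrow> prefix_complexity U (str z) \<le> enat L" for z L
    by (simp add: D_def short_iff_prefix_complexity)
  have "decidable_in A D"
    unfolding D_def by (rule semidecidable_decidable_in_halting_problem[OF K]) (intro comp_intros)
  note [comp_intros] = decidable_comp[OF this]
  define lvl where "lvl = (\<lambda>n. LEAST L. \<forall>z<2 ^ Suc n. 2 ^ n \<le> Suc z \<and> Suc z < 2 ^ Suc n \<longrightarrow> D (pair z L))"
  have lvl_ex: "\<exists>L. \<forall>z<2 ^ Suc n. 2 ^ n \<le> Suc z \<and> Suc z < 2 ^ Suc n \<longrightarrow> D (pair z L)" for n
    using full_ex[of n] unfolding full_def D_def by auto
  have "computable_in A lvl"
    unfolding lvl_def by (intro comp_intros lvl_ex)
  note [comp_intros] = computable_comp[OF this]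
  have lvl: "prefix_complexity U (str z) \<le> enat (lvl n)" if "2 ^ n \<le> Suc z" "Suc z < 2 ^ Suc n" for z n
    using LeastI_ex[OF lvl_ex[of n]] that unfolding lvl_def D by auto
  \<comment> \<open>\<open>lvl n\<close> is the maximal complexity at length \<open>n\<close>, so a
    maximal string is one not reached at \<open>lvl n - 1\<close>; at 0, where subtraction
    truncates, any string will do.\<close>
  define P where "P = (\<lambda>n z. 2 ^ n \<le> Suc z \<and> Suc z < 2 ^ Suc n \<and> (lvl n = 0 \<or> \<not> D (pair z (lvl n - 1))))"
  have P_ex: "\<exists>z. P n z" for n
  proof (cases "lvl n = 0")
    case True
    then show ?thesis by (intro exI[of _ "2 ^ n - 1"]) (simp add: P_def)
  next
    case False
    then have "lvl n - 1 < lvl n" by simp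
    then have "\<not> (\<forall>z<2 ^ Suc n. 2 ^ n \<le> Suc z \<and> Suc z < 2 ^ Suc n \<longrightarrow> D (pair z (lvl n - 1)))"
      unfolding lvl_def by (rule not_less_Least)
    then show ?thesis unfolding P_def by blast
  qed
  define F where "F = (\<lambda>n. str (LEAST z. P n z))"
  have "computable_in A (\<lambda>n. LEAST z. P n z)"
    unfolding P_def by (intro comp_intros P_ex[unfolded P_def])
  then have "string_fun_computable_in A F"
    by (simp add: string_fun_computable_in_def F_def)
  moreover have "length (F n) = n \<and> prefix_complexity U x \<le> prefix_complexity U (F n)" if "length x = n" for n x
  proof
    have z: "P n (LEAST z. P n z)" using P_ex by (rule LeastI_ex)
    then show "length (F n) = n" unfolding F_def P_def length_str_eq_iff by blast
    have "prefix_complexity U x \<le> enat (lvl n)"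
      using lvl[of n "string_code x"] string_code_bounds[of x] that by simp
    also have "\<dots> \<le> prefix_complexity U (F n)"
    proof (cases "lvl n")
      case (Suc m)
      then have "\<not> prefix_complexity U (F n) \<le> enat m"
        using z unfolding P_def F_def D by simp
      then show ?thesis using Suc by (simp add: Suc_ile_eq)
    qed (simp add: zero_enat_def[symmetric])
    finally show "prefix_complexity U x \<le> prefix_complexity U (F n)" .
  qed
  ultimately show ?thesis by blast
qed

end

section \<open>The games\<close>

text \<open>Class \<open>v\<close> of the requests receives the share \<open>2^-(v+1)\<close>.
  Nested uses charge a coded tuple one component at a time.\<close>

lemma weight_split:
  fixes f :: "nat \<Rightarrow> real" and p :: "nat \<Rightarrow> nat"
  assumes "finite I" "0 \<le> c" and *: "\<And>v. v \<in> p ` I \<Longrightarrow> (\<Sum>i | i \<in> I \<and> p i = v. f i) \<le> c * (1 / 2) ^ Suc v"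
  shows "(\<Sum>i\<in>I. f i) \<le> c"
proof -
  have "(\<Sum>i\<in>I. f i) = (\<Sum>v\<in>p ` I. \<Sum>i | i \<in> I \<and> p i = v. f i)"
    by (rule sum.image_gen[OF assms(1)])
  also have "\<dots> \<le> (\<Sum>v\<in>p ` I. c * (1 / 2) ^ Suc v)" by (intro sum_mono *)
  also have "\<dots> = c * (\<Sum>v\<in>p ` I. (1 / 2) ^ Suc v)" by (simp only: sum_distrib_left)
  also have "\<dots> \<le> c" using sum_half_powers_le[of "p ` I"] assms by (intro mult_left_le) auto
  finally show ?thesis .
qed

lemma weight_count:
  fixes f :: "nat \<Rightarrow> real" and p :: "nat \<Rightarrow> nat"
  assumes "finite I" "0 \<le> c" "\<And>i. i \<in> I \<Longrightarrow> p i < M"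
    and *: "\<And>v. v \<in> p ` I \<Longrightarrow> (\<Sum>i | i \<in> I \<and> p i = v. f i) \<le> c"
  shows "(\<Sum>i\<in>I. f i) \<le> real M * c"
proof -
  have "(\<Sum>i\<in>I. f i) = (\<Sum>v\<in>p ` I. \<Sum>i | i \<in> I \<and> p i = v. f i)"
    by (rule sum.image_gen[OF assms(1)])
  also have "\<dots> \<le> (\<Sum>v\<in>p ` I. c)" by (intro sum_mono *)
  also have "\<dots> = real (card (p ` I)) * c" by simp
  also have "card (p ` I) \<le> card {..<M}" by (rule card_mono) (use assms(3) in auto)
  then have "real (card (p ` I)) * c \<le> real M * c" using assms(2) by (intro mult_right_mono) auto
  finally show ?thesis .
qed

lemma weight_single:
  fixes f :: "nat \<Rightarrow> real"
  assumes "\<And>i j. i \<in> I \<Longrightarrow> j \<in> I \<Longrightarrow> i = j" "0 \<le> c" "\<And>i. i \<in> I \<Longrightarrow> f i \<le> c"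
  shows "(\<Sum>i\<in>I. f i) \<le> c"
proof (cases "I = {}")
  case False
  then obtain i where "I = {i}" using assms(1) by blast
  then show ?thesis using assms(3) by simp
qed (use assms(2) in simp)

lemma uniform_stage:
  fixes P :: "nat \<Rightarrow> nat \<Rightarrow> bool"
  assumes "\<And>y. y < M \<Longrightarrow> \<exists>s. P s y" and mono: "\<And>s s' y. P s y \<Longrightarrow> s \<le> s' \<Longrightarrow> P s' y"
  shows "\<exists>s. \<forall>y<M. P s y"
proof -
  obtain f where f: "\<And>y. y < M \<Longrightarrow> P (f y) y" using assms(1) by metis
  have "P (Max (f ` {..<M})) y" if "y < M" for y
    using that by (intro mono[OF f]) (auto intro!: Max_ge)
  then show ?thesis by blast
qed

text \<open>The number \<open>j\<close> is read as an infinite sequence, of which finitely many entries matter.\<close>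

definition elt :: "nat \<Rightarrow> nat \<Rightarrow> nat" where
  "elt j i = pfst ((psnd ^^ i) j)"

lemma computable_elt [comp_intros]:
  "computable_in A j \<Longrightarrow> computable_in A i \<Longrightarrow> computable_in A (\<lambda>x. elt (j x) (i x))"
  unfolding elt_def by (intro comp_intros computable_funpow)

lemma ex_elt: "\<exists>j. \<forall>i<h. elt j i = f i"
proof (induction h arbitrary: f)
  case (Suc h)
  obtain j where j: "\<forall>i<h. elt j i = f (Suc i)" using Suc[of "\<lambda>i. f (Suc i)"] by blast
  have "elt (pair (f 0) j) 0 = f 0" "elt (pair (f 0) j) (Suc i) = elt j i" for i
    by (simp_all add: elt_def funpow_Suc_right del: funpow.simps(2))
  then have "\<forall>i<Suc h. elt (pair (f 0) j) i = f i" using j by (metis less_Suc_eq_0_disj)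
  then show ?case ..
qed simp

text \<open>
  Game \<open>j\<close> is played on the lengths \<open>pos k j y\<close>, and \<open>m\<close> stands for the excess over \<open>N\<close> of the largest
  complexity among the strings of length \<open>N\<close>; it falls with time. Heights are capped at \<open>4\<^sup>k - 1\<close> so that
  they are residues modulo \<open>4\<^sup>k\<close>. A block at height \<open>h\<close> has \<open>2 ^ blk k j h\<close> elements; a block at height
  \<open>h + 1\<close> contains more disjoint blocks at height \<open>h\<close> than there are lengths with \<open>m < 2\<^sup>h \<cdot> wt k j\<close>.
\<close>

definition wt :: "nat \<Rightarrow> nat \<Rightarrow> nat" where
  "wt k j = j + 4 ^ k + 2 * k"

definition blk :: "nat \<Rightarrow> nat \<Rightarrow> nat \<Rightarrow> nat" where
  "blk k j g = (2 ^ g - 1) * wt k j"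

text \<open>The shift by \<open>2 * k\<close> makes \<open>4 ^ k\<close> divide the number of
  strings of the length, so every residue occurs equally often. For fixed \<open>k\<close> the
  length determines \<open>j\<close> and \<open>y\<close>.\<close>

definition pos :: "nat \<Rightarrow> nat \<Rightarrow> nat \<Rightarrow> nat" where
  "pos k j y = pair j y + 2 * k"

definition hgt :: "nat \<Rightarrow> nat \<Rightarrow> nat \<Rightarrow> nat" where
  "hgt k j m = (LEAST h. 4 ^ k - 1 \<le> h \<or> m < 2 ^ h * wt k j)"

lemma wt_pos: "0 < wt k j"
  by (simp add: wt_def)

lemma blk_add_wt: "blk k j g + wt k j = 2 ^ g * wt k j"
  by (simp add: blk_def diff_mult_distrib)

text \<open>The first summand is the binary logarithm of the number of disjoint sub-blocks of height
  \<open>g\<close> in a block of height \<open>g + 1\<close>.\<close>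

lemma blk_Suc: "blk k j (Suc g) = 2 ^ g * wt k j + blk k j g"
  using blk_add_wt[of k j g] blk_add_wt[of k j "Suc g"] by simp

lemma hgt_cases: "hgt k j m = 4 ^ k - 1 \<or> m < 2 ^ hgt k j m * wt k j"
proof -
  have "4 ^ k - 1 \<le> hgt k j m \<or> m < 2 ^ hgt k j m * wt k j"
    unfolding hgt_def by (rule LeastI[of _ "4 ^ k - 1"]) simp
  moreover have "hgt k j m \<le> 4 ^ k - 1" unfolding hgt_def by (rule Least_le) simp
  ultimately show ?thesis by linarith
qed

lemma hgt_less: "hgt k j m < 4 ^ k"
proof -
  have "hgt k j m \<le> 4 ^ k - 1" unfolding hgt_def by (rule Least_le) simp
  moreover have "(0::nat) < 4 ^ k" by simp
  ultimately show ?thesis by linarith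
qed

lemma hgt_le: "m < 2 ^ h * wt k j \<Longrightarrow> hgt k j m \<le> h"
  unfolding hgt_def by (rule Least_le) simp

lemma computable_wt [comp_intros]:
  "computable_in A k \<Longrightarrow> computable_in A j \<Longrightarrow> computable_in A (\<lambda>x. wt (k x) (j x))"
  unfolding wt_def by (intro comp_intros)

lemma computable_blk [comp_intros]:
  "computable_in A k \<Longrightarrow> computable_in A j \<Longrightarrow> computable_in A g \<Longrightarrow>
    computable_in A (\<lambda>x. blk (k x) (j x) (g x))"
  unfolding blk_def by (intro comp_intros)

lemma computable_pos [comp_intros]:
  "computable_in A k \<Longrightarrow> computable_in A j \<Longrightarrow> computable_in A y \<Longrightarrow>
    computable_in A (\<lambda>x. pos (k x) (j x) (y x))"
  unfolding pos_def by (intro comp_intros)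

lemma computable_hgt [comp_intros]:
  assumes "computable_in A k" "computable_in A j" "computable_in A m"
  shows "computable_in A (\<lambda>x. hgt (k x) (j x) (m x))"
proof -
  note [comp_intros] = assms[THEN computable_comp]
  show ?thesis unfolding hgt_def by (intro comp_intros assms) blast
qed

section \<open>Dynamics of a game, and the two machines built from it\<close>

context universal_machine
begin

text \<open>By stage \<open>s\<close> the excess is seen to be below the threshold of height
  \<open>g\<close>; \<open>- 1\<close> turns this strict bound into the weak one of
  \<open>full\<close>.\<close>

definition low :: "nat \<Rightarrow> nat \<Rightarrow> nat \<Rightarrow> nat \<Rightarrow> nat \<Rightarrow> bool" where
  "low k j s y g \<longleftrightarrow> full s (pos k j y) (pos k j y + 2 ^ g * wt k j - 1)"

lemma low_mono: "low k j s y g \<Longrightarrow> s \<le> s' \<Longrightarrow> low k j s' y g"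
  unfolding low_def using full_mono by blast

lemma decidable_low [comp_intros]:
  "computable_in A k \<Longrightarrow> computable_in A j \<Longrightarrow> computable_in A s \<Longrightarrow> computable_in A y \<Longrightarrow>
    computable_in A g \<Longrightarrow> decidable_in A (\<lambda>x. low (k x) (j x) (s x) (y x) (g x))"
  unfolding low_def by (intro comp_intros)

text \<open>The first disjunct makes the search total without knowing that a suitable sub-block
  exists.\<close>

definition next_block :: "nat \<Rightarrow> nat \<Rightarrow> nat \<Rightarrow> nat \<Rightarrow> nat \<Rightarrow> nat" where
  "next_block k j s a g = (LEAST i. 2 ^ (2 ^ g * wt k j) \<le> i \<or>
     (\<forall>y<2 ^ blk k j g. \<not> low k j s (a + i * 2 ^ blk k j g + y) g))"

lemma computable_next_block [comp_intros]:
  assumes "computable_in A k" "computable_in A j" "computable_in A s" "computable_in A a" "computable_in A g"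
  shows "computable_in A (\<lambda>x. next_block (k x) (j x) (s x) (a x) (g x))"
proof -
  note [comp_intros] = assms[THEN computable_comp]
  show ?thesis unfolding next_block_def by (intro comp_intros assms) blast
qed

text \<open>Pigeonhole: one low length in each of the \<open>2 ^ (2 ^ g * wt k j)\<close> sub-blocks
  would be twice as many as \<open>card_full_le\<close> permits.\<close>

lemma next_block:
  shows "next_block k j s a g < 2 ^ (2 ^ g * wt k j)"
    and "y < 2 ^ blk k j g \<Longrightarrow> \<not> low k j s (a + next_block k j s a g * 2 ^ blk k j g + y) g"
proof -
  define M :: nat where "M = 2 ^ (2 ^ g * wt k j)"
  define B :: nat where "B = 2 ^ blk k j g"
  have "\<exists>i<M. \<forall>y<B. \<not> low k j s (a + i * B + y) g"
  proof (rule ccontr)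
    assume "\<not> (\<exists>i<M. \<forall>y<B. \<not> low k j s (a + i * B + y) g)"
    then have "\<forall>i. \<exists>y. i < M \<longrightarrow> y < B \<and> low k j s (a + i * B + y) g" by blast
    then obtain f where f: "\<And>i. i < M \<Longrightarrow> f i < B" "\<And>i. i < M \<Longrightarrow> low k j s (a + i * B + f i) g"
      by metis
    have inj: "inj_on (\<lambda>i. pos k j (a + i * B + f i)) {..<M}"
    proof (rule inj_onI)
      fix i i' assume ii: "i \<in> {..<M}" "i' \<in> {..<M}" "pos k j (a + i * B + f i) = pos k j (a + i' * B + f i')"
      then have "(i * B + f i) div B = (i' * B + f i') div B" by (simp add: pos_def)
      then show "i = i'" using f(1)[of i] f(1)[of i'] ii by (auto simp: div_mult_self3)
    qed
    have m: "0 < 2 ^ g * wt k j" using wt_pos by simp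
    have "card ((\<lambda>i. pos k j (a + i * B + f i)) ` {..<M}) \<le> 2 ^ (2 ^ g * wt k j - 1)"
    proof (rule card_full_le)
      fix N assume "N \<in> (\<lambda>i. pos k j (a + i * B + f i)) ` {..<M}"
      then obtain i where "i < M" "N = pos k j (a + i * B + f i)" by auto
      then have "full s N (N + (2 ^ g * wt k j - 1))" using f(2)[of i] m by (simp add: low_def)
      then show "\<exists>s. full s N (N + (2 ^ g * wt k j - 1))" ..
    qed simp
    then have "M \<le> 2 ^ (2 ^ g * wt k j - 1)" by (simp add: card_image[OF inj])
    moreover have "(2::nat) ^ (2 ^ g * wt k j - 1) < M" unfolding M_def by (rule power_strict_increasing) (use m in auto)
    ultimately show False by linarith
  qed
  then obtain i where i: "i < M" "\<forall>y<B. \<not> low k j s (a + i * B + y) g" by blast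
  let ?Q = "\<lambda>i. M \<le> i \<or> (\<forall>y<B. \<not> low k j s (a + i * B + y) g)"
  have n: "next_block k j s a g = (LEAST i. ?Q i)" by (simp only: next_block_def M_def B_def)
  have "(LEAST i. ?Q i) \<le> i" by (rule Least_le) (use i in blast)
  then have *: "next_block k j s a g < M" using i(1) n by linarith
  then show "next_block k j s a g < 2 ^ (2 ^ g * wt k j)" by (simp only: M_def)
  have "?Q (LEAST i. ?Q i)" by (rule LeastI[of ?Q i]) (use i in blast)
  then show "y < 2 ^ blk k j g \<Longrightarrow> \<not> low k j s (a + next_block k j s a g * 2 ^ blk k j g + y) g"
    using * unfolding n[symmetric] B_def[symmetric] by auto
qed

text \<open>
  The state is a pair of a height \<open>h\<close> and the first element of the current block. When entry \<open>h - 1\<close> of the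
  sequence \<open>j\<close> enters the halting problem, the game moves to a block of height \<open>h - 1\<close> without low lengths.
\<close>

definition step :: "nat \<Rightarrow> nat \<Rightarrow> nat \<Rightarrow> nat \<Rightarrow> nat" where
  "step k j s v =
     (if 0 < pfst v \<and> halted (Suc s) (elt j (pfst v - 1)) \<and> \<not> halted s (elt j (pfst v - 1))
      then pair (pfst v - 1)
             (psnd v + next_block k j s (psnd v) (pfst v - 1) * 2 ^ blk k j (pfst v - 1))
      else v)"

definition state :: "nat \<Rightarrow> nat \<Rightarrow> nat \<Rightarrow> nat" where
  "state k j s = rec_nat (pair (4 ^ k - 1) 0) (step k j) s"

lemma state_0: "state k j 0 = pair (4 ^ k - 1) 0"
  and state_Suc: "state k j (Suc s) = step k j s (state k j s)"
  by (simp_all add: state_def)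

lemma computable_state [comp_intros]:
  assumes "computable_in A k" "computable_in A j" "computable_in A s"
  shows "computable_in A (\<lambda>x. state (k x) (j x) (s x))"
proof -
  note [comp_intros] = assms[THEN computable_comp]
  show ?thesis unfolding state_def step_def by (intro comp_intros assms)
qed

lemma state_stable:
  assumes "state k j s = pair h a" "s \<le> s'"
    and "\<And>t. s \<le> t \<Longrightarrow> t < s' \<Longrightarrow> h = 0 \<or> halted t (elt j (h - 1)) \<or> \<not> halted (Suc t) (elt j (h - 1))"
  shows "state k j s' = pair h a"
  using assms(2,3)
proof (induction s' rule: dec_induct)
  case (step t)
  then have "state k j t = pair h a" by simp
  moreover have "h = 0 \<or> halted t (elt j (h - 1)) \<or> \<not> halted (Suc t) (elt j (h - 1))" using step by simp
  ultimately show ?case by (auto simp: state_Suc step_def)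
qed (rule assms(1))

lemma state_decreasing:
  "s \<le> s' \<Longrightarrow> pfst (state k j s') < pfst (state k j s) \<or> state k j s' = state k j s"
proof (induction s' rule: dec_induct)
  case (step t)
  have "pfst (state k j (Suc t)) < pfst (state k j t) \<or> state k j (Suc t) = state k j t"
    by (auto simp: state_Suc step_def)
  then show ?case using step.IH by fastforce
qed simp

text \<open>A change of state lowers the height, so a game occupies one block per height, and only
  that block has to be paid for in \<open>raise_ex\<close>.\<close>

lemma state_unique: "state k j s = pair h a \<Longrightarrow> state k j s' = pair h a' \<Longrightarrow> a = a'"
  using state_decreasing[of s s' k j] state_decreasing[of s' s k j] by (cases "s \<le> s'") auto

text \<open>All strings of the lengths in a current block receive programs. The shares
  \<open>2^-(k+1)\<close>, \<open>2^-(j+1)\<close>, \<open>2^-(h+1)\<close> for the parameters,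
  \<open>2^-blk\<close> for a length of the block and \<open>2^-N\<close> for a string of length
  \<open>N\<close> sum to at most 1. The 3 collects the three successors.\<close>

lemma raise_ex:
  "\<exists>c. \<forall>k j s h a y. state k j s = pair h a \<longrightarrow> y < 2 ^ blk k j h \<longrightarrow>
     (\<exists>t. full t (pos k j (a + y)) (pos k j (a + y) + j + h + blk k j h + k + 3 + c))"
proof -
  define K where "K = (\<lambda>i. pfst i)"
  define J where "J = (\<lambda>i. pfst (psnd i))"
  define H where "H = (\<lambda>i. pfst (psnd (psnd i)))"
  define A where "A = (\<lambda>i. pfst (psnd (psnd (psnd i))))"
  define Y where "Y = (\<lambda>i. pfst (psnd (psnd (psnd (psnd i)))))"
  define R where "R = (\<lambda>i. psnd (psnd (psnd (psnd (psnd i)))))"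
  note proj = K_def J_def H_def A_def Y_def R_def
  have eqI: "i = i'" if "K i = K i'" "J i = J i'" "H i = H i'" "A i = A i'" "Y i = Y i'" "R i = R i'" for i i'
    using that unfolding proj by (metis prod.collapse prod_decode_inverse)
  define N where "N = (\<lambda>i. pos (K i) (J i) (A i + Y i))"
  define E where "E = (\<lambda>t i. state (K i) (J i) t = pair (H i) (A i) \<and> Y i < 2 ^ blk (K i) (J i) (H i) \<and> R i < 2 ^ N i)"
  define l where "l = (\<lambda>i. N i + blk (K i) (J i) (H i) + Suc (H i) + Suc (J i) + Suc (K i))"
  have "\<exists>c. \<forall>i. (\<exists>t. E t i) \<longrightarrow> (\<exists>\<tau>. U \<tau> = Some (str (2 ^ N i - 1 + R i)) \<and> length \<tau> \<le> l i + c)"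
  proof (rule kraft_chaitin)
    show "decidable_in {} (\<lambda>z. E (pfst z) (psnd z))"
      unfolding E_def N_def proj by (intro comp_intros)
    show "computable_in {} l" "computable_in {} (\<lambda>i. 2 ^ N i - 1 + R i)"
      unfolding l_def N_def proj by (intro comp_intros)+
    fix I assume fin: "finite I" and E: "\<And>i. i \<in> I \<Longrightarrow> \<exists>t. E t i"
    have A_eq: "A i = A i'" if "i \<in> I" "i' \<in> I" "K i = K i'" "J i = J i'" "H i = H i'" for i i'
      using E[OF that(1)] E[OF that(2)] that(3-5) state_unique unfolding E_def by metis
    show "(\<Sum>i\<in>I. (1 / 2) ^ l i) \<le> (1 :: real)"
    proof (rule weight_split[where p = K])
      fix k
      show "(\<Sum>i | i \<in> I \<and> K i = k. (1 / 2) ^ l i) \<le> 1 * (1 / 2 :: real) ^ Suc k"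
      proof (rule weight_split[where p = J])
        fix j
        let ?I = "{i \<in> {i \<in> I. K i = k}. J i = j}"
        show "(\<Sum>i\<in>?I. (1 / 2) ^ l i) \<le> 1 * (1 / 2 :: real) ^ Suc k * (1 / 2) ^ Suc j"
        proof (rule weight_split[where p = H])
          fix h
          let ?B = "blk k j h"
          let ?c = "(1 / 2 :: real) ^ (?B + Suc h + Suc j + Suc k)"
          have "(\<Sum>i | i \<in> ?I \<and> H i = h. (1 / 2) ^ l i) \<le> real (2 ^ ?B) * ?c"
          proof (rule weight_count[where p = Y])
            fix y
            let ?I' = "{i \<in> {i \<in> ?I. H i = h}. Y i = y}"
            assume "y \<in> Y ` {i \<in> ?I. H i = h}"
            then obtain i0 where i0: "i0 \<in> ?I'" by auto
            have N_eq: "N i = N i0" if "i \<in> ?I'" for i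
              using that i0 A_eq[of i i0] by (auto simp: N_def)
            have "(\<Sum>i\<in>?I'. (1 / 2) ^ l i) \<le> real (2 ^ N i0) * (1 / 2 :: real) ^ (N i0 + (?B + Suc h + Suc j + Suc k))"
            proof (rule weight_count[where p = R])
              show "R i < 2 ^ N i0" if "i \<in> ?I'" for i
                using E[of i] that N_eq[OF that] by (auto simp: E_def)
              fix r
              show "(\<Sum>i | i \<in> ?I' \<and> R i = r. (1 / 2) ^ l i)
                  \<le> (1 / 2 :: real) ^ (N i0 + (?B + Suc h + Suc j + Suc k))"
              proof (rule weight_single)
                show "i = i'" if "i \<in> {i. i \<in> ?I' \<and> R i = r}" "i' \<in> {i. i \<in> ?I' \<and> R i = r}" for i i'
                  by (rule eqI) (use that A_eq[of i i'] in auto)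
                show "(1 / 2 :: real) ^ l i \<le> (1 / 2) ^ (N i0 + (?B + Suc h + Suc j + Suc k))"
                  if "i \<in> {i. i \<in> ?I' \<and> R i = r}" for i
                  using that N_eq[of i] by (auto simp: l_def add_ac)
              qed simp
            qed (use fin in auto)
            also have "\<dots> = ?c" by (simp add: power_add power_divide)
            finally show "(\<Sum>i\<in>?I'. (1 / 2) ^ l i) \<le> ?c" .
          next
            show "Y i < 2 ^ ?B" if "i \<in> {i \<in> ?I. H i = h}" for i
              using E[of i] that by (auto simp: E_def)
          qed (use fin in auto)
          also have "\<dots> = 1 * (1 / 2 :: real) ^ Suc k * (1 / 2) ^ Suc j * (1 / 2) ^ Suc h"
            by (simp add: power_add power_divide)
          finally show "(\<Sum>i | i \<in> ?I \<and> H i = h. (1 / 2) ^ l i) \<le> \<dots>" .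
        qed (use fin in auto)
      qed (use fin in auto)
    qed (use fin in auto)
  qed
  then obtain c where c: "\<And>i. \<exists>t. E t i \<Longrightarrow> \<exists>\<tau>. U \<tau> = Some (str (2 ^ N i - 1 + R i)) \<and> length \<tau> \<le> l i + c"
    by blast
  have "\<exists>t. full t (pos k j (a + y)) (pos k j (a + y) + j + h + blk k j h + k + 3 + c)"
    if s: "state k j s = pair h a" and y: "y < 2 ^ blk k j h" for k j s h a y
    unfolding full_iff
  proof (intro allI impI)
    fix x :: "bool list" assume x: "length x = pos k j (a + y)"
    define r where "r = Suc (string_code x) - 2 ^ length x"
    have b: "2 ^ length x \<le> Suc (string_code x)" "Suc (string_code x) < 2 * 2 ^ length x"
      using string_code_bounds[of x] by simp_all
    define i where "i = pair k (pair j (pair h (pair a (pair y r))))"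
    have i: "K i = k" "J i = j" "H i = h" "A i = a" "Y i = y" "R i = r" "N i = length x"
      by (simp_all add: proj N_def i_def x)
    have "r < 2 ^ length x" using b by (simp add: r_def)
    then have "E s i" using s y by (simp add: E_def i)
    then obtain \<tau> where \<tau>: "U \<tau> = Some (str (2 ^ N i - 1 + R i))" "length \<tau> \<le> l i + c" using c by blast
    have "2 ^ N i - 1 + R i = string_code x" using b by (simp add: i r_def)
    then have "U \<tau> = Some x" using \<tau>(1) by simp
    moreover have "length \<tau> \<le> pos k j (a + y) + j + h + blk k j h + k + 3 + c"
      using \<tau>(2) by (simp add: l_def i x)
    ultimately show "prefix_complexity U x \<le> enat (pos k j (a + y) + j + h + blk k j h + k + 3 + c)"
      unfolding prefix_complexity_le_iff by blast
  qed
  then show ?thesis by blast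
qed

definition mu :: "nat \<Rightarrow> nat" where
  "mu N = (LEAST m. \<exists>s. full s N (N + m))"

lemma full_mu: "\<exists>s. full s N (N + mu N)"
proof -
  obtain s L where "full s N L" using full_ex by blast
  then have "full s N (N + (L - N))" using full_ge by simp
  then have "\<exists>m. \<exists>s. full s N (N + m)" by blast
  then show ?thesis unfolding mu_def by (rule LeastI_ex)
qed

lemma mu_le: "full s N (N + m) \<Longrightarrow> mu N \<le> m"
  unfolding mu_def by (rule Least_le) blast

lemma low_iff: "(\<exists>s. low k j s y g) \<longleftrightarrow> mu (pos k j y) < 2 ^ g * wt k j"
proof -
  let ?N = "pos k j y"
  have pos: "0 < 2 ^ g * wt k j" using wt_pos by simp
  then have eq: "?N + 2 ^ g * wt k j - 1 = ?N + (2 ^ g * wt k j - 1)" by simp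
  show ?thesis
  proof
    assume "\<exists>s. low k j s y g"
    then have "mu ?N \<le> 2 ^ g * wt k j - 1" unfolding low_def eq using mu_le by blast
    then show "mu ?N < 2 ^ g * wt k j" using pos by linarith
  next
    assume "mu ?N < 2 ^ g * wt k j"
    then have "?N + mu ?N \<le> ?N + 2 ^ g * wt k j - 1" by linarith
    then show "\<exists>s. low k j s y g" unfolding low_def using full_mu[of ?N] full_mono[OF _ order_refl] by blast
  qed
qed

text \<open>
  Whenever the excess reaches a value \<open>m\<close>, a fraction \<open>4\<^sup>-\<^sup>k\<close> of the strings of that length gets programs
  about \<open>2 k\<close> bits shorter. The index \<open>k\<close> of the game costs only \<open>k + 1\<close> bits, which leaves a gain.
\<close>

lemma prohibit_ex:
  "\<exists>c. \<forall>k j y x. length x = pos k j y \<longrightarrow>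
     (Suc (string_code x) - 2 ^ length x) mod 4 ^ k = hgt k j (mu (length x)) \<longrightarrow>
     prefix_complexity U x \<le> enat (length x - 2 * k + mu (length x) + k + 2 + c)"
proof -
  define K where "K = (\<lambda>i. pfst i)"
  define J where "J = (\<lambda>i. pfst (psnd i))"
  define Y where "Y = (\<lambda>i. pfst (psnd (psnd i)))"
  define M where "M = (\<lambda>i. pfst (psnd (psnd (psnd i))))"
  define R where "R = (\<lambda>i. psnd (psnd (psnd (psnd i))))"
  note proj = K_def J_def Y_def M_def R_def
  have eqI: "i = i'" if "K i = K i'" "J i = J i'" "Y i = Y i'" "M i = M i'" "R i = R i'" for i i'
    using that unfolding proj by (metis prod.collapse prod_decode_inverse)
  define N where "N = (\<lambda>i. pos (K i) (J i) (Y i))"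
  define E where "E = (\<lambda>t i. full t (N i) (N i + M i) \<and> R i < 2 ^ (N i - 2 * K i))"
  define l where "l = (\<lambda>i. N i - 2 * K i + M i + K i + 2)"
  \<comment> \<open>Among the strings of length \<open>N i\<close>, the one whose rank has quotient
    \<open>R i\<close> and residue the height belonging to \<open>M i\<close>.\<close>
  define x where "x = (\<lambda>i. 2 ^ N i - 1 + (R i * 4 ^ K i + hgt (K i) (J i) (M i)))"
  have "\<exists>c. \<forall>i. (\<exists>t. E t i) \<longrightarrow> (\<exists>\<tau>. U \<tau> = Some (str (x i)) \<and> length \<tau> \<le> l i + c)"
  proof (rule kraft_chaitin)
    show "decidable_in {} (\<lambda>z. E (pfst z) (psnd z))"
      unfolding E_def N_def proj by (intro comp_intros)
    show "computable_in {} l" "computable_in {} x"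
      unfolding l_def x_def N_def proj by (intro comp_intros)+
    fix I assume fin: "finite I" and E: "\<And>i. i \<in> I \<Longrightarrow> \<exists>t. E t i"
    show "(\<Sum>i\<in>I. (1 / 2) ^ l i) \<le> (1 :: real)"
    proof (rule weight_split[where p = K])
      fix k
      define Ik where "Ik = {i \<in> I. K i = k}"
      have fink: "finite Ik" using fin by (simp add: Ik_def)
      have "(\<Sum>i\<in>Ik. (1 / 2 :: real) ^ l i) = (\<Sum>n\<in>N ` Ik. \<Sum>i | i \<in> Ik \<and> N i = n. (1 / 2) ^ l i)"
        by (rule sum.image_gen[OF fink])
      also have "\<dots> \<le> (\<Sum>n\<in>N ` Ik. (1 / 2 :: real) ^ Suc k * (2 ^ n * (1 / 2) ^ (n + mu n)))"
      proof (rule sum_mono)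
        fix n
        let ?I = "{i. i \<in> Ik \<and> N i = n}"
        have M: "mu n \<le> M i" if "i \<in> ?I" for i
          using E[of i] that mu_le unfolding E_def Ik_def by blast
        \<comment> \<open>At one length only excesses \<open>M i\<close> from \<open>mu n\<close>
          upwards are ever seen. They form a geometric series dominated by its first term; Kraft's
          inequality for \<open>U\<close> then bounds the sum over all lengths. The 2 in
          \<open>l\<close> pays for this series and for the share of \<open>k\<close>.\<close>
        have "(\<Sum>i\<in>?I. (1 / 2 :: real) ^ l i) \<le> (1 / 2) ^ (k + 1 + mu n)"
        proof (rule weight_split[where p = "\<lambda>i. M i - mu n"])
          fix v
          let ?I' = "{i. i \<in> ?I \<and> M i - mu n = v}"
          have "(\<Sum>i\<in>?I'. (1 / 2 :: real) ^ l i)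
              \<le> real (2 ^ (n - 2 * k)) * (1 / 2) ^ (n - 2 * k + (mu n + v) + k + 2)"
          proof (rule weight_count[where p = R])
            show "R i < 2 ^ (n - 2 * k)" if "i \<in> ?I'" for i
              using E[of i] that by (auto simp: E_def Ik_def)
            fix r
            show "(\<Sum>i | i \<in> ?I' \<and> R i = r. (1 / 2 :: real) ^ l i) \<le> (1 / 2) ^ (n - 2 * k + (mu n + v) + k + 2)"
            proof (rule weight_single)
              show "i = i'" if "i \<in> {i. i \<in> ?I' \<and> R i = r}" "i' \<in> {i. i \<in> ?I' \<and> R i = r}" for i i'
              proof (rule eqI)
                show "M i = M i'" using that M[of i] M[of i'] by auto
                have "N i = N i'" "K i = K i'" using that by (auto simp: Ik_def)
                then show "J i = J i'" "Y i = Y i'" by (auto simp: N_def pos_def)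
              qed (use that in \<open>auto simp: Ik_def\<close>)
              show "(1 / 2 :: real) ^ l i \<le> (1 / 2) ^ (n - 2 * k + (mu n + v) + k + 2)"
                if "i \<in> {i. i \<in> ?I' \<and> R i = r}" for i
              proof -
                have "M i = mu n + v" using that M[of i] by auto
                then show ?thesis using that by (auto simp: l_def Ik_def)
              qed
            qed simp
          qed (use fink in auto)
          also have "\<dots> = (1 / 2) ^ (k + 1 + mu n) * (1 / 2) ^ Suc v"
            by (simp add: power_add power_divide)
          finally show "(\<Sum>i\<in>?I'. (1 / 2 :: real) ^ l i) \<le> (1 / 2) ^ (k + 1 + mu n) * (1 / 2) ^ Suc v" .
        qed (use fink in auto)
        also have "\<dots> = (1 / 2 :: real) ^ Suc k * (2 ^ n * (1 / 2) ^ (n + mu n))"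
          by (simp add: power_add power_divide)
        finally show "(\<Sum>i\<in>?I. (1 / 2 :: real) ^ l i) \<le> (1 / 2) ^ Suc k * (2 ^ n * (1 / 2) ^ (n + mu n))" .
      qed
      also have "\<dots> = (1 / 2) ^ Suc k * (\<Sum>n\<in>N ` Ik. 2 ^ n * (1 / 2) ^ (n + mu n))"
        by (simp only: sum_distrib_left)
      also have "\<dots> \<le> (1 / 2) ^ Suc k * 1"
        by (rule mult_left_mono, rule full_weight) (use fink full_mu in auto)
      finally show "(\<Sum>i | i \<in> I \<and> K i = k. (1 / 2) ^ l i) \<le> 1 * (1 / 2 :: real) ^ Suc k"
        by (simp add: Ik_def)
    qed (use fin in auto)
  qed
  then obtain c where c: "\<And>i. \<exists>t. E t i \<Longrightarrow> \<exists>\<tau>. U \<tau> = Some (str (x i)) \<and> length \<tau> \<le> l i + c"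
    by blast
  have "prefix_complexity U z \<le> enat (length z - 2 * k + mu (length z) + k + 2 + c)"
    if z: "length z = pos k j y" and h: "(Suc (string_code z) - 2 ^ length z) mod 4 ^ k = hgt k j (mu (length z))"
    for k j y z
  proof -
    define r where "r = Suc (string_code z) - 2 ^ length z"
    have b: "2 ^ length z \<le> Suc (string_code z)" "Suc (string_code z) < 2 * 2 ^ length z"
      using string_code_bounds[of z] by simp_all
    define i where "i = pair k (pair j (pair y (pair (mu (length z)) (r div 4 ^ k))))"
    have i: "K i = k" "J i = j" "Y i = y" "M i = mu (length z)" "R i = r div 4 ^ k" "N i = length z"
      by (simp_all add: proj N_def i_def z)
    have "(2::nat) ^ length z = 2 ^ (length z - 2 * k) * 4 ^ k"
    proof -
      have "(4::nat) ^ k = 2 ^ (2 * k)" by (simp add: power_mult)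
      moreover have "length z = length z - 2 * k + 2 * k" using z by (simp add: pos_def)
      ultimately show ?thesis by (metis power_add)
    qed
    moreover have "r < 2 ^ length z" using b by (simp add: r_def)
    ultimately have "r div 4 ^ k < 2 ^ (length z - 2 * k)" by (simp add: less_mult_imp_div_less)
    then have "\<exists>t. E t i" using full_mu[of "length z"] by (simp add: E_def i)
    then obtain \<tau> where \<tau>: "U \<tau> = Some (str (x i))" "length \<tau> \<le> l i + c" using c by blast
    have "x i = 2 ^ length z - 1 + r" by (simp only: x_def i h[symmetric] r_def[symmetric] div_mult_mod_eq)
    also have "\<dots> = string_code z" using b by (simp add: r_def)
    finally have "U \<tau> = Some z" using \<tau>(1) by simp
    then show ?thesis using \<tau>(2) unfolding prefix_complexity_le_iff by (auto simp: l_def i)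
  qed
  then show ?thesis by blast
qed

end

section \<open>The halting problem from strings of maximal complexity\<close>

context universal_machine
begin

text \<open>Otherwise \<open>prohibit_ex\<close> would put the complexity of \<open>x\<close>, and
  by maximality that of all strings of its length, below length plus \<open>mu\<close>, since the
  gain \<open>k\<close> exceeds \<open>c + 2\<close>. This contradicts the minimality of
  \<open>mu\<close>.\<close>

lemma maximal_complexity_avoids_height:
  "\<exists>c. \<forall>k>c. \<forall>j y x. length x = pos k j y \<longrightarrow>
     (\<forall>x'. length x' = length x \<longrightarrow> prefix_complexity U x' \<le> prefix_complexity U x) \<longrightarrow>
     (Suc (string_code x) - 2 ^ length x) mod 4 ^ k \<noteq> hgt k j (mu (length x))"
proof -
  obtain c where c: "\<And>k j y x. length x = pos k j y \<Longrightarrow>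
     (Suc (string_code x) - 2 ^ length x) mod 4 ^ k = hgt k j (mu (length x)) \<Longrightarrow>
     prefix_complexity U x \<le> enat (length x - 2 * k + mu (length x) + k + 2 + c)"
    using prohibit_ex by blast
  have "(Suc (string_code x) - 2 ^ length x) mod 4 ^ k \<noteq> hgt k j (mu (length x))"
    if k: "c + 2 < k" and x: "length x = pos k j y"
      and max: "\<And>x'. length x' = length x \<Longrightarrow> prefix_complexity U x' \<le> prefix_complexity U x"
    for k j y x
  proof
    let ?N = "length x"
    let ?L = "?N - 2 * k + mu ?N + k + 2 + c"
    assume "(Suc (string_code x) - 2 ^ ?N) mod 4 ^ k = hgt k j (mu ?N)"
    then have "prefix_complexity U x \<le> enat ?L" by (rule c[OF x])
    then have "\<forall>x'. length x' = ?N \<longrightarrow> prefix_complexity U x' \<le> enat ?L"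
      using max order_trans by blast
    then obtain s where s: "full s ?N ?L" unfolding full_iff[symmetric] by blast
    have "?N \<le> ?L" using s by (rule full_ge)
    then have "?L = ?N + (?L - ?N)" by linarith
    then have "mu ?N \<le> ?L - ?N" using mu_le[of s ?N "?L - ?N"] s by simp
    moreover have "2 * k \<le> ?N" using x by (simp add: pos_def)
    ultimately show False using k \<open>?N \<le> ?L\<close> by linarith
  qed
  then have "\<forall>k>c + 2. \<forall>j y x. length x = pos k j y \<longrightarrow>
     (\<forall>x'. length x' = length x \<longrightarrow> prefix_complexity U x' \<le> prefix_complexity U x) \<longrightarrow>
     (Suc (string_code x) - 2 ^ length x) mod 4 ^ k \<noteq> hgt k j (mu (length x))" by blast
  then show ?thesis by blast
qed

text \<open>As \<open>blk + wt\<close> equals the threshold \<open>2 ^ h * wt\<close>, it suffices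
  that \<open>wt\<close> exceeds the overhead \<open>j + h + k + 3 + c\<close>: its part
  \<open>4 ^ k\<close> absorbs \<open>h\<close>, its part \<open>2 * k\<close> absorbs
  \<open>k\<close> and the constant.\<close>

lemma block_low:
  "\<exists>c. \<forall>k>c. \<forall>j s h a y. state k j s = pair h a \<longrightarrow> h < 4 ^ k - 1 \<longrightarrow> y < 2 ^ blk k j h \<longrightarrow>
     (\<exists>t. low k j t (a + y) h)"
proof -
  obtain c where c: "\<And>k j s h a y. state k j s = pair h a \<Longrightarrow> y < 2 ^ blk k j h \<Longrightarrow>
     \<exists>t. full t (pos k j (a + y)) (pos k j (a + y) + j + h + blk k j h + k + 3 + c)"
    using raise_ex by blast
  have "\<exists>t. low k j t (a + y) h"
    if k: "c + 3 < k" and h: "h < 4 ^ k - 1" and s: "state k j s = pair h a" and y: "y < 2 ^ blk k j h"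
    for k j s h a y
  proof -
    let ?N = "pos k j (a + y)"
    have "j + h + k + 4 + c \<le> wt k j" using k h by (simp add: wt_def)
    then have "?N + j + h + blk k j h + k + 3 + c \<le> ?N + 2 ^ h * wt k j - 1"
      unfolding blk_add_wt[symmetric] by linarith
    then show ?thesis unfolding low_def using c[OF s y] full_mono[OF _ order_refl] by blast
  qed
  then show ?thesis by blast
qed

text \<open>
  If \<open>halting_problem\<close> is not reducible to \<open>A\<close>, then for every \<open>h\<close> there is a game in which \<open>\<tau>\<close>
  avoids all values \<open>\<ge> h\<close> on the part of the current block that still has height \<open>\<ge> h\<close>. In the step from
  \<open>g + 1\<close> to \<open>g\<close>, some \<open>x\<close> enters the halting problem only after such a stage: otherwise these stages
  would enumerate the complement of the halting problem in \<open>A\<close>. For \<open>h = 0\<close> the condition is absurd.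
\<close>

lemma avoiding_heights_computes_halting_problem:
  fixes \<tau> :: "nat \<Rightarrow> nat \<Rightarrow> nat"
  assumes \<tau>: "computable_in A (\<lambda>z. \<tau> (pfst z) (psnd z))"
    and less: "\<And>j y. \<tau> j y < 4 ^ k"
    and avoid: "\<And>j y. \<tau> j y \<noteq> hgt k j (mu (pos k j y))"
    and low: "\<And>j s h a y. state k j s = pair h a \<Longrightarrow> h < 4 ^ k - 1 \<Longrightarrow> y < 2 ^ blk k j h \<Longrightarrow>
      \<exists>t. low k j t (a + y) h"
  shows "halting_problem \<le>\<^sub>T A"
proof (rule ccontr)
  assume notred: "\<not> halting_problem \<le>\<^sub>T A"
  define good where "good = (\<lambda>h j t. pfst (state k j t) = h \<and>
    (\<forall>y<2 ^ blk k j h. h = 0 \<or> \<not> low k j t (psnd (state k j t) + y) (h - 1) \<longrightarrow>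
       \<tau> j (psnd (state k j t) + y) < h))"
  have comp_\<tau>: "computable_in A (\<lambda>x. \<tau> (f x) (g x))" if "computable_in A f" "computable_in A g" for f g
    using computable_comp[OF \<tau> computable_pair[OF that]] by simp
  have dec_good: "decidable_in A (\<lambda>x. good h (f x) (g x))" if "computable_in A f" "computable_in A g" for f g h
  proof -
    note [comp_intros] = that[THEN computable_comp]
    show ?thesis unfolding good_def by (intro comp_intros comp_\<tau> that)
  qed
  \<comment> \<open>In a game that stays at height \<open>h\<close>, a value \<tau> equal to
    \<open>h\<close> forces the true height below \<open>h\<close>, which becomes visible at some
    stage. A block is finite, so one stage serves all its lengths.\<close>
  have settle: "\<exists>t. good h j t"
    if s: "state k j s = pair h a" and stop: "h = 0 \<or> elt j (h - 1) \<notin> halting_problem"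
      and y: "\<And>y. y < 2 ^ blk k j h \<Longrightarrow> \<tau> j (a + y) \<le> h \<and> hgt k j (mu (pos k j (a + y))) \<le> h"
    for h j s a
  proof -
    have stable: "state k j t = pair h a" if "s \<le> t" for t
      by (rule state_stable[OF s that]) (use stop halting_problem_iff in blast)
    have "\<exists>t. \<tau> j (a + y) = h \<longrightarrow> h \<noteq> 0 \<and> low k j t (a + y) (h - 1)" if "y < 2 ^ blk k j h" for y
    proof (cases "\<tau> j (a + y) = h")
      case True
      let ?m = "mu (pos k j (a + y))"
      have "hgt k j ?m < h" using y[OF that] avoid[of j "a + y"] True by linarith
      \<comment> \<open>This rules out the cap in \<open>hgt_cases\<close>, so the height really
        bounds the excess.\<close>
      moreover have "h \<le> 4 ^ k - 1" using less[of j "a + y"] True by linarith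
      ultimately have "?m < 2 ^ hgt k j ?m * wt k j" using hgt_cases[of k j ?m] by linarith
      also have "\<dots> \<le> 2 ^ (h - 1) * wt k j"
        using \<open>hgt k j ?m < h\<close> by (intro mult_right_mono power_increasing) auto
      finally have "\<exists>t. low k j t (a + y) (h - 1)" unfolding low_iff .
      then show ?thesis using \<open>hgt k j ?m < h\<close> by auto
    qed simp
    then have "\<exists>t. \<forall>y<2 ^ blk k j h. \<tau> j (a + y) = h \<longrightarrow> h \<noteq> 0 \<and> low k j t (a + y) (h - 1)"
      by (rule uniform_stage) (use low_mono in blast)+
    then obtain t where t: "\<And>y. y < 2 ^ blk k j h \<Longrightarrow> \<tau> j (a + y) = h \<Longrightarrow>
        h \<noteq> 0 \<and> low k j t (a + y) (h - 1)" by blast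
    have "good h j (max s t)"
      unfolding good_def stable[of "max s t", simplified] prod_encode_inverse fst_conv snd_conv
    proof (intro conjI allI impI refl)
      fix y' assume y': "y' < 2 ^ blk k j h" "h = 0 \<or> \<not> low k j (max s t) (a + y') (h - 1)"
      have "\<tau> j (a + y') \<noteq> h" using t[OF y'(1)] y'(2) low_mono[of k j t _ _ "max s t"] by auto
      then show "\<tau> j (a + y') < h" using y[OF y'(1)] by linarith
    qed
    then show ?thesis ..
  qed
  \<comment> \<open>Only the first \<open>h\<close> entries are prescribed: the later ones are those
    that have driven the game down to height \<open>h\<close>, and the induction chooses
    them.\<close>
  have "h \<le> 4 ^ k - 1 \<Longrightarrow> (\<forall>i<h. elt j i \<notin> halting_problem) \<Longrightarrow>
    \<exists>j' t. (\<forall>i<h. elt j' i = elt j i) \<and> good h j' t" for h j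
  proof (induction h arbitrary: j rule: inc_induct)
    case base
    have "\<tau> j (0 + y) \<le> 4 ^ k - 1 \<and> hgt k j (mu (pos k j (0 + y))) \<le> 4 ^ k - 1" for y
      using less[of j "0 + y"] hgt_less[of k j "mu (pos k j (0 + y))"] by linarith
    moreover have "4 ^ k - 1 = (0::nat) \<or> elt j (4 ^ k - 1 - 1) \<notin> halting_problem"
      using base by (metis diff_less less_one neq0_conv)
    ultimately have "\<exists>t. good (4 ^ k - 1) j t" by (intro settle[OF state_0])
    then show ?case by blast
  next
    case (step g)
    \<comment> \<open>\<open>z\<close> codes a game with entry \<open>g\<close> equal to
      \<open>x\<close> and a stage at which it is good for \<open>g + 1\<close> while
      \<open>x\<close> has not yet been seen to halt.\<close>
    define P where "P = (\<lambda>x z. (\<forall>i<g. elt (pfst z) i = elt j i) \<and> elt (pfst z) g = x \<and>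
      good (Suc g) (pfst z) (psnd z) \<and> \<not> halted (psnd z) x)"
    have "decidable_in A (\<lambda>z. P (pfst z) (psnd z))"
      unfolding P_def by (intro comp_intros dec_good)
    then have "\<not> (\<forall>x. x \<notin> halting_problem \<longleftrightarrow> (\<exists>z. P x z))"
      using halting_problem_reducibleI notred by blast
    moreover have "\<exists>z. P x z" if x: "x \<notin> halting_problem" for x
    proof -
      obtain j1 where j1: "\<forall>i<Suc g. elt j1 i = (if i < g then elt j i else x)"
        using ex_elt[of "Suc g" "\<lambda>i. if i < g then elt j i else x"] by (elim exE)
      then have "\<forall>i<Suc g. elt j1 i \<notin> halting_problem" using step.prems x by (simp add: less_Suc_eq)
      then obtain j' t where "\<forall>i<Suc g. elt j' i = elt j1 i" "good (Suc g) j' t" using step.IH by blast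
      then have "P x (pair j' t)"
        using j1 x halting_problem_iff by (auto simp: P_def)
      then show ?thesis ..
    qed
    ultimately obtain x z where x: "x \<in> halting_problem" and "P x z" by blast
    define j' where "j' = pfst z"
    define t where "t = psnd z"
    have j': "\<forall>i<g. elt j' i = elt j i" "elt j' g = x" and t: "good (Suc g) j' t" "\<not> halted t x"
      using \<open>P x z\<close> by (auto simp: P_def j'_def t_def)
    define a where "a = psnd (state k j' t)"
    have state_t: "state k j' t = pair (Suc g) a"
      using t(1) by (metis a_def good_def prod.collapse prod_decode_inverse)
    obtain s where s: "halted (Suc s) x" "\<not> halted s x"
    proof -
      obtain s where "halted s x" "\<forall>s'<s. \<not> halted s' x"
        using x halting_problem_iff exists_least_iff[of "\<lambda>s. halted s x"] by blast
      then show thesis using that by (cases s) auto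
    qed
    have ts: "t \<le> s" using s(1) t(2) halted_mono not_less_eq_eq by blast
    have state_s: "state k j' s = pair (Suc g) a"
    proof (rule state_stable[OF state_t ts])
      fix s' assume "s' < s"
      then have "\<not> halted (Suc s') x" using s(2) halted_mono Suc_leI by blast
      then show "Suc g = 0 \<or> halted s' (elt j' (Suc g - 1)) \<or> \<not> halted (Suc s') (elt j' (Suc g - 1))"
        using j'(2) by simp
    qed
    define i where "i = next_block k j' s a g"
    define B :: nat where "B = 2 ^ blk k j' g"
    have state': "state k j' (Suc s) = pair g (a + i * B)"
      using s j'(2) by (simp add: state_Suc state_s step_def i_def B_def)
    \<comment> \<open>The new block has no low length at stage \<open>s\<close>, hence none at the
      earlier stage \<open>t\<close>, where goodness bounds \<tau> on it. Its own height is bounded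
      because the game now pays for it.\<close>
    have block: "\<tau> j' (a + i * B + y) \<le> g \<and> hgt k j' (mu (pos k j' (a + i * B + y))) \<le> g" if y: "y < B" for y
    proof
      have "i * B + y < Suc i * B" using y by simp
      also have "\<dots> \<le> 2 ^ (2 ^ g * wt k j') * B"
        using next_block(1)[of k j' s a g] by (intro mult_right_mono) (auto simp: i_def Suc_le_eq)
      also have "\<dots> = 2 ^ blk k j' (Suc g)" by (simp add: B_def blk_Suc power_add)
      finally have "i * B + y < 2 ^ blk k j' (Suc g)" .
      moreover have "\<not> low k j' s (a + i * B + y) g"
        using next_block(2)[of y k j' g s a] y by (simp add: B_def i_def)
      then have "\<not> low k j' t (a + (i * B + y)) (Suc g - 1)"
        using low_mono[OF _ ts] by (auto simp: add.assoc)
      ultimately have "\<tau> j' (a + (i * B + y)) < Suc g"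
        using t(1) unfolding good_def a_def[symmetric] by blast
      then show "\<tau> j' (a + i * B + y) \<le> g" by (simp add: add.assoc)
      have "\<exists>t. low k j' t (a + i * B + y) g"
        using low[OF state' _ y[unfolded B_def]] step.hyps by simp
      then show "hgt k j' (mu (pos k j' (a + i * B + y))) \<le> g"
        unfolding low_iff by (rule hgt_le)
    qed
    have "g = 0 \<or> elt j' (g - 1) \<notin> halting_problem"
      using step.prems j'(1) by (cases g) auto
    then have "\<exists>t. good g j' t"
      using block unfolding B_def by (intro settle[OF state'[unfolded B_def]]) auto
    then show ?case using j'(1) by blast
  qed
  from this[of 0 0] obtain j t where "good 0 j t" by auto
  moreover have "(0::nat) < 2 ^ blk k j 0" by simp
  ultimately show False unfolding good_def by blast
qed

lemma maximal_complexity_computes_halting_problem: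
  assumes F: "string_fun_computable_in A F"
    and max: "\<And>n x. length x = n \<Longrightarrow>
      length (F n) = n \<and> prefix_complexity U x \<le> prefix_complexity U (F n)"
  shows "halting_problem \<le>\<^sub>T A"
proof -
  obtain c where c: "\<And>k j y x. c < k \<Longrightarrow> length x = pos k j y \<Longrightarrow>
     (\<And>x'. length x' = length x \<Longrightarrow> prefix_complexity U x' \<le> prefix_complexity U x) \<Longrightarrow>
     (Suc (string_code x) - 2 ^ length x) mod 4 ^ k \<noteq> hgt k j (mu (length x))"
    using maximal_complexity_avoids_height by blast
  obtain c' where c': "\<And>k j s h a y. c' < k \<Longrightarrow> state k j s = pair h a \<Longrightarrow> h < 4 ^ k - 1 \<Longrightarrow>
     y < 2 ^ blk k j h \<Longrightarrow> \<exists>t. low k j t (a + y) h"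
    using block_low by blast
  \<comment> \<open>Possible because both constants stem from machines that do not depend on
    \<open>k\<close>.\<close>
  define k where "k = Suc (c + c')"
  define \<tau> where "\<tau> = (\<lambda>j y. (Suc (string_code (F (pos k j y))) - 2 ^ pos k j y) mod 4 ^ k)"
  have len: "length (F n) = n" for n using max[of "replicate n True" n] by simp
  show ?thesis
  proof (rule avoiding_heights_computes_halting_problem[of A \<tau> k])
    have "computable_in A (\<lambda>n. string_code (F n))"
      using F by (simp add: string_fun_computable_in_def)
    note [comp_intros] = computable_comp[OF this]
    show "computable_in A (\<lambda>z. \<tau> (pfst z) (psnd z))"
      unfolding \<tau>_def by (intro comp_intros)
    show "\<tau> j y < 4 ^ k" for j y by (simp add: \<tau>_def)
    show "\<tau> j y \<noteq> hgt k j (mu (pos k j y))" for j y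
      using c[of k "F (pos k j y)" j y] max by (simp add: \<tau>_def len k_def)
    show "\<exists>t. low k j t (a + y) h"
      if "state k j s = pair h a" "h < 4 ^ k - 1" "y < 2 ^ blk k j h" for j s h a y
      by (rule c'[OF _ that]) (simp add: k_def)
  qed
qed

end

theorem theorem4p3:
  fixes U :: "bool list \<Rightarrow> bool list option" and A :: "nat set"
  assumes "universal_prefix_free_machine U"
  shows "halting_problem \<le>\<^sub>T A \<longleftrightarrow>
    (\<exists>F :: nat \<Rightarrow> bool list. string_fun_computable_in A F \<and>
       (\<forall>n. \<forall>x. length x = n \<longrightarrow>
          length (F n) = n \<and> prefix_complexity U x \<le> prefix_complexity U (F n)))"
proof -
  interpret universal_machine U by unfold_locales (rule assms)
  show ?thesis
    using maximal_complexity_computable[of A] maximal_complexity_computes_halting_problem[of A] by blast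
qed

end
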